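(* Let $k$ be a field with $\mathrm{char}(k)=0$ and let $q\in k^\times$ be either not a root of unity or a $p$-th root of unity for an odd integer $p$. Let $d,e\ge0$ be integers. Then the quantum symmetric power $V\mapsto S^d_q(V)$, the quantum exterior power $V\mapsto\Lambda^d_q(V)$ and the quantum divided power $V\mapsto\Gamma^d_q(V)$ (where a morphism $f\in\mathrm{Hom}_{\mathcal B_d}(V^{\otimes d},W^{\otimes d})$ acts by the map induced by $f$ on the quotients $S^d_q$, respectively by restriction of $f$ to the subspaces $\Lambda^d_q$ and $\Gamma^d_q$) are quantum polynomial functors, i.e. objects of $\mathcal P^d_{q,e}$.
   Context: $\mathcal B_d$ is the Artin braid group with generators $T_1,\dots,T_{d-1}$ (trivial for $d\le 1$). $\mathcal V$ is the category of finite dimensional $k$-vector spaces. $V_n$ is the $n$-dimensional space with basis $v_1,\dots,v_n$, and $R_n\in\mathrm{End}(V_n\otimes V_n)$ is given by $R_n(v_i\otimes v_j)=v_j\otimes v_i$ if $i<j$, $=q\,v_i\otimes v_i$ if $i=j$, $=(q-q^{-1})v_i\otimes v_j+v_j\otimes v_i$ if $i>j$. Write $R_n(v_i\otimes v_j)=\sum_{k,l}(R_n)^{kl}_{ij}v_k\otimes v_l$. $A_q(n,n)$ is the algebra generated by $x_{ij}$ ($1\le i,j\le n$) with relations $\sum_{k,l}(R_n)^{pq}_{kl}x_{ki}x_{lj}=\sum_{k,l}(R_n)^{kl}_{ij}x_{pk}x_{ql}$; it is a bialgebra graded by $\deg x_{ij}=1$, with $\Delta(x_{ij})=\sum_k x_{ik}\otimes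 x_{kj}$, $\epsilon(x_{ij})=\delta_{ij}$, and $V_n$ is a right comodule via $v_i\mapsto\sum_j v_j\otimes x_{ji}$. The category of finite dimensional right $A_q(n,n)$-comodules is braided monoidal; its braiding $R_{V,W}:V\otimes W\to W\otimes V$ is natural in comodule maps, satisfies $R_{V\otimes W,U}=(R_{V,U}\otimes 1)(1\otimes R_{W,U})$ and $R_{V,W\otimes U}=(1\otimes R_{V,U})(R_{V,W}\otimes 1)$, and $R_{V_n,V_n}=R_n$. Put $R_V:=R_{V,V}$. $T_i\in\mathcal B_d$ acts on $V^{\otimes d}$ by $R_V$ in tensor positions $i,i+1$. An $e$-Hecke pair is a finite dimensional right $A_q(n,n)$-comodule $V$, for some $n\ge1$, whose coaction has image in $V\otimes A_q(n,n)_e$. $\Gamma^d_{q,e}\mathcal V$ is the category whose objects are all $e$-Hecke pairs (all $n\geq 1$), with $\mathrm{Hom}(V,W)=\mathrm{Hom}_{\mathcal B_d}(V^{\otimes d},W^{\otimes d})$. $\mathcal P^d_{q,e}$ is the category of $k$-linear functors $\Gamma^d_{q,e}\mathcal V\to\mathcal V$. For an $e$-Hecke pair $V$ define $\Lambda^2_q(V):=\sum_{i\in\mathbb Z}\{w\in V^{\otimes2}\mid (R_V+q^i)^Nw=0\text{ for }N\gg0\}$ and $\Gamma^2_q(V):=\sum_{i\in\mathbb Z}\{w\in V^{\otimes2}\mid (R_V-q^i)^Nw=0\text{ for }N\gg0\}$. With the subscript $i,i+1$ indicating tensor positions, $S^d_q(V):=V^{\otimes d}\big/\sum_{1\le i\le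 d-1}V\otimes\cdots\otimes\Lambda^2_q(V)_{i,i+1}\otimes\cdots\otimes V$, $\Lambda^d_q(V):=\bigcap_{1\le i\le d-1}V\otimes\cdots\otimes\Lambda^2_q(V)_{i,i+1}\otimes\cdots\otimes V$, $\Gamma^d_q(V):=\bigcap_{1\le i\le d-1}V\otimes\cdots\otimes\Gamma^2_q(V)_{i,i+1}\otimes\cdots\otimes V$ (inside $V^{\otimes d}$; an empty intersection is $V^{\otimes d}$). *)

theory Defs
  imports
    "Jordan_Normal_Form.VS_Connect"
    "HOL-Algebra.QuotRing"
begin

section \<open>Vector spaces and tensor products\<close>

text \<open>The field \<open>k\<close> is a type \<open>'k\<close>; vector spaces over it are module records over
  \<^term>\<open>class_ring\<close>, with an arbitrary carrier set.\<close>

abbreviation vspace :: "('k::field, 'v) module \<Rightarrow> bool"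
  where "vspace V \<equiv> vectorspace class_ring V"

abbreviation lin_map :: "('k::field, 'v) module \<Rightarrow> ('k, 'w) module \<Rightarrow> ('v \<Rightarrow> 'w) \<Rightarrow> bool"
  where "lin_map V W f \<equiv> linear_map class_ring V W f"

abbreviation vspan :: "('k::field, 'v) module \<Rightarrow> 'v set \<Rightarrow> 'v set"
  where "vspan V S \<equiv> LinearCombinations.module.span class_ring V S"

abbreviation functionals :: "('k::field, 'i \<Rightarrow> 'k) module"
  where "functionals \<equiv> ring.func_space class_ring UNIV"

definition linear_form :: "('k::field, 'v) module \<Rightarrow> ('v \<Rightarrow> 'k) \<Rightarrow> bool"
  where "linear_form V f \<longleftrightarrow>
    (\<forall>x\<in>carrier V. \<forall>y\<in>carrier V. f (x \<oplus>\<^bsub>V\<^esub> y) = f x + f y) \<and>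
    (\<forall>c. \<forall>x\<in>carrier V. f (c \<odot>\<^bsub>V\<^esub> x) = c * f x)"

definition bilinear_form ::
    "('k::field, 'v) module \<Rightarrow> ('k, 'w) module \<Rightarrow> ('v \<Rightarrow> 'w \<Rightarrow> 'k) \<Rightarrow> bool"
  where "bilinear_form V W B \<longleftrightarrow>
    (\<forall>x\<in>carrier V. linear_form W (B x)) \<and>
    (\<forall>y\<in>carrier W. linear_form V (\<lambda>x. B x y))"

definition trilinear_form ::
    "('k::field, 'u) module \<Rightarrow> ('k, 'v) module \<Rightarrow> ('k, 'w) module \<Rightarrow> ('u \<Rightarrow> 'v \<Rightarrow> 'w \<Rightarrow> 'k) \<Rightarrow> bool"
  where "trilinear_form U V W B \<longleftrightarrow>
    (\<forall>x\<in>carrier U. bilinear_form V W (B x)) \<and>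
    (\<forall>y\<in>carrier V. \<forall>z\<in>carrier W. linear_form U (\<lambda>x. B x y z))"

definition multilinear_form :: "nat \<Rightarrow> ('k::field, 'v) module \<Rightarrow> ('v list \<Rightarrow> 'k) \<Rightarrow> bool"
  where "multilinear_form d V M \<longleftrightarrow>
    (\<forall>xs ys. set xs \<subseteq> carrier V \<and> set ys \<subseteq> carrier V \<and> length xs + 1 + length ys = d \<longrightarrow>
      linear_form V (\<lambda>x. M (xs @ x # ys)))"

text \<open>The tensor product \<open>V \<otimes> W\<close> is realised inside the space of functionals on bilinear
  forms, as the span of the evaluations \<open>x \<otimes> y = (B \<mapsto> B x y)\<close>; over a field this is
  the usual tensor product. Functionals take the value 0 on functions that are not bilinear, so
  that equality of tensors is equality of functionals. Maps of tensors are written by composition: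
  if \<open>t = (\<Sum>i. x\<^sub>i \<otimes> y\<^sub>i)\<close> then \<open>t (\<lambda>x y. \<dots>)\<close> is the sum of \<open>\<dots>\<close> over all
  \<open>(x, y) = (x\<^sub>i, y\<^sub>i)\<close>.\<close>

type_synonym ('k, 'v, 'w) tensor = "('v \<Rightarrow> 'w \<Rightarrow> 'k) \<Rightarrow> 'k"
type_synonym ('k, 'v) tensors = "('v list \<Rightarrow> 'k) \<Rightarrow> 'k"

definition pure :: "('k::field, 'v) module \<Rightarrow> ('k, 'w) module \<Rightarrow> 'v \<Rightarrow> 'w \<Rightarrow> ('k, 'v, 'w) tensor"
  where "pure V W x y = (\<lambda>B. if bilinear_form V W B then B x y else 0)"

definition tens ::
    "('k::field, 'v) module \<Rightarrow> ('k, 'w) module \<Rightarrow> ('k, ('k, 'v, 'w) tensor) module"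
  where "tens V W = functionals\<lparr>carrier :=
    vspan functionals {pure V W x y | x y. x \<in> carrier V \<and> y \<in> carrier W}\<rparr>"

definition tens_map :: "('k::field, 'v1) module \<Rightarrow> ('k, 'w1) module \<Rightarrow>
    ('v \<Rightarrow> 'v1) \<Rightarrow> ('w \<Rightarrow> 'w1) \<Rightarrow> ('k, 'v, 'w) tensor \<Rightarrow> ('k, 'v1, 'w1) tensor"
  where "tens_map V1 W1 g h t =
    (\<lambda>B. if bilinear_form V1 W1 B then t (\<lambda>x y. B (g x) (h y)) else 0)"

definition pure_power :: "nat \<Rightarrow> ('k::field, 'v) module \<Rightarrow> 'v list \<Rightarrow> ('k, 'v) tensors"
  where "pure_power d V xs = (\<lambda>M. if multilinear_form d V M then M xs else 0)"

definition tens_power :: "nat \<Rightarrow> ('k::field, 'v) module \<Rightarrow> ('k, ('k, 'v) tensors) module"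
  where "tens_power d V = functionals\<lparr>carrier :=
    vspan functionals {pure_power d V xs | xs. set xs \<subseteq> carrier V \<and> length xs = d}\<rparr>"

text \<open>\<open>x\<^sub>1 \<otimes> \<dots> \<otimes> x\<^sub>r \<otimes> w \<otimes> y\<^sub>1 \<otimes> \<dots> \<otimes> y\<^sub>s\<close> for \<open>w \<in> V \<otimes> V\<close>\<close>

definition pure_insert :: "nat \<Rightarrow> ('k::field, 'v) module \<Rightarrow>
    'v list \<Rightarrow> ('k, 'v, 'v) tensor \<Rightarrow> 'v list \<Rightarrow> ('k, 'v) tensors"
  where "pure_insert d V xs w ys =
    (\<lambda>M. if multilinear_form d V M then w (\<lambda>x y. M (xs @ [x, y] @ ys)) else 0)"

text \<open>\<open>V \<otimes> \<dots> \<otimes> L\<^bsub>i,i+1\<^esub> \<otimes> \<dots> \<otimes> V\<close> for a subspace \<open>L\<close> of \<open>V \<otimes> V\<close>\<close>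

definition at_position :: "nat \<Rightarrow> ('k::field, 'v) module \<Rightarrow>
    nat \<Rightarrow> ('k, 'v, 'v) tensor set \<Rightarrow> ('k, 'v) tensors set"
  where "at_position d V i L = vspan (tens_power d V)
    {pure_insert d V xs w ys | xs w ys. set xs \<subseteq> carrier V \<and> set ys \<subseteq> carrier V \<and>
       length xs + 1 = i \<and> i + 1 + length ys = d \<and> w \<in> L}"

definition map_at_position :: "nat \<Rightarrow> ('k::field, 'v) module \<Rightarrow>
    (('k, 'v, 'v) tensor \<Rightarrow> ('k, 'v, 'v) tensor) \<Rightarrow> nat \<Rightarrow> ('k, 'v) tensors \<Rightarrow> ('k, 'v) tensors"
  where "map_at_position d V f i t =
    (\<lambda>M. if multilinear_form d V M
         then t (\<lambda>xs. f (pure V V (xs ! (i - 1)) (xs ! i)) (\<lambda>y z. M (xs[i - 1 := y, i := z])))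
         else 0)"

definition quot_smult :: "('k::field, 'v) module \<Rightarrow> 'v set \<Rightarrow> 'k \<Rightarrow> 'v set \<Rightarrow> 'v set"
  where "quot_smult V L c C = L <+>\<^bsub>V\<^esub> ((\<lambda>x. c \<odot>\<^bsub>V\<^esub> x) ` C)"

text \<open>The fields \<^const>\<open>mult\<close> and \<^const>\<open>one\<close> play no role for a vector space.\<close>

definition quot_space :: "('k::field, 'v) module \<Rightarrow> 'v set \<Rightarrow> ('k, 'v set) module"
  where "quot_space V L = \<lparr>carrier = a_rcosets\<^bsub>V\<^esub> L, mult = (\<lambda>_ _. L), one = L, zero = L,
    add = set_add V, smult = quot_smult V L\<rparr>"


section \<open>The bialgebra \<open>A\<^sub>q(n,n)\<close>\<close>

text \<open>\<open>R_entry q k l i j\<close> is the coefficient of \<open>v\<^sub>k \<otimes> v\<^sub>l\<close> in \<open>R\<^sub>n (v\<^sub>i \<otimes> v\<^sub>j)\<close>.\<close>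

definition R_entry :: "'k::field \<Rightarrow> nat \<Rightarrow> nat \<Rightarrow> nat \<Rightarrow> nat \<Rightarrow> 'k"
  where "R_entry q k l i j =
    (if i < j then (if (k, l) = (j, i) then 1 else 0)
     else if i = j then (if (k, l) = (i, i) then q else 0)
     else (if (k, l) = (i, j) then q - inverse q else 0) + (if (k, l) = (j, i) then 1 else 0))"

text \<open>Noncommutative polynomials in \<open>x\<^sub>i\<^sub>j\<close>: finitely supported functions on words in the
  index pairs.\<close>

type_synonym 'k ncpoly = "(nat \<times> nat) list \<Rightarrow> 'k"

definition free_alg :: "nat \<Rightarrow> ('k::field, 'k ncpoly) module"
  where "free_alg n = \<lparr>
    carrier = {f. finite {w. f w \<noteq> 0} \<and> (\<forall>w. f w \<noteq> 0 \<longrightarrow> set w \<subseteq> {1..n} \<times> {1..n})},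
    mult = (\<lambda>f g w. \<Sum>i\<le>length w. f (take i w) * g (drop i w)),
    one = (\<lambda>w. if w = [] then 1 else 0),
    zero = (\<lambda>w. 0),
    add = (\<lambda>f g w. f w + g w),
    smult = (\<lambda>c f w. c * f w)\<rparr>"

definition monomial :: "(nat \<times> nat) list \<Rightarrow> 'k::field ncpoly"
  where "monomial u = (\<lambda>w. if w = u then 1 else 0)"

definition Aq_relation :: "'k::field \<Rightarrow> nat \<Rightarrow> nat \<Rightarrow> nat \<Rightarrow> nat \<Rightarrow> nat \<Rightarrow> 'k ncpoly"
  where "Aq_relation q n a b i j = (\<lambda>w.
    (\<Sum>k\<in>{1..n}. \<Sum>l\<in>{1..n}. R_entry q a b k l * monomial [(k, i), (l, j)] w) -
    (\<Sum>k\<in>{1..n}. \<Sum>l\<in>{1..n}. R_entry q k l i j * monomial [(a, k), (b, l)] w))"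

definition Aq_ideal :: "'k::field \<Rightarrow> nat \<Rightarrow> 'k ncpoly set"
  where "Aq_ideal q n = genideal (free_alg n)
    {Aq_relation q n a b i j | a b i j. a \<in> {1..n} \<and> b \<in> {1..n} \<and> i \<in> {1..n} \<and> j \<in> {1..n}}"

definition Aq :: "'k::field \<Rightarrow> nat \<Rightarrow> ('k, 'k ncpoly set) module"
  where "Aq q n = ring.extend (free_alg n Quot Aq_ideal q n)
    (module.fields (quot_smult (free_alg n) (Aq_ideal q n)))"

definition Aq_class :: "'k::field \<Rightarrow> nat \<Rightarrow> 'k ncpoly \<Rightarrow> 'k ncpoly set"
  where "Aq_class q n f = Aq_ideal q n +>\<^bsub>free_alg n\<^esub> f"

definition Aq_gen :: "'k::field \<Rightarrow> nat \<Rightarrow> nat \<Rightarrow> nat \<Rightarrow> 'k ncpoly set"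
  where "Aq_gen q n i j = Aq_class q n (monomial [(i, j)])"

definition Aq_degree :: "'k::field \<Rightarrow> nat \<Rightarrow> nat \<Rightarrow> 'k ncpoly set set"
  where "Aq_degree q n e =
    Aq_class q n ` {f \<in> carrier (free_alg n). \<forall>w. f w \<noteq> 0 \<longrightarrow> length w = e}"

text \<open>The multiplicative extensions of \<open>\<Delta>(x\<^sub>i\<^sub>j) = (\<Sum>k. x\<^sub>i\<^sub>k \<otimes> x\<^sub>k\<^sub>j)\<close> and
  \<open>\<epsilon>(x\<^sub>i\<^sub>j) = \<delta>\<^sub>i\<^sub>j\<close>, written out on words. The ideal of relations is a biideal, hence
  the chosen representative of a coset is immaterial.\<close>

definition comult :: "'k::field \<Rightarrow> nat \<Rightarrow>
    'k ncpoly set \<Rightarrow> ('k, 'k ncpoly set, 'k ncpoly set) tensor"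
  where "comult q n a = (\<lambda>B. if bilinear_form (Aq q n) (Aq q n) B
    then let f = (SOME f. f \<in> a) in
      \<Sum>w | f w \<noteq> 0. f w * (\<Sum>ks | set ks \<subseteq> {1..n} \<and> length ks = length w.
        B (Aq_class q n (monomial (zip (map fst w) ks))) (Aq_class q n (monomial (zip ks (map snd w)))))
    else 0)"

definition counit :: "'k::field ncpoly set \<Rightarrow> 'k"
  where "counit a = (let f = (SOME f. f \<in> a) in
    \<Sum>w | f w \<noteq> 0. f w * (if \<forall>(i, j)\<in>set w. i = j then 1 else 0))"


section \<open>Comodules and the braiding\<close>

record ('k, 'v) comodule =
  space :: "('k, 'v) module"
  coact :: "'v \<Rightarrow> ('k, 'v, 'k ncpoly set) tensor"

text \<open>Finite dimensional right \<open>A\<^sub>q(n,n)\<close>-comodules; the last two conditions are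
  \<open>(\<rho> \<otimes> 1) \<rho> = (1 \<otimes> \<Delta>) \<rho>\<close> and \<open>(1 \<otimes> \<epsilon>) \<rho> = 1\<close>.\<close>

definition fd_comodule :: "'k::field \<Rightarrow> nat \<Rightarrow> ('k, 'v) comodule \<Rightarrow> bool"
  where "fd_comodule q n V \<longleftrightarrow>
    vspace (space V) \<and> vectorspace.fin_dim class_ring (space V) \<and>
    lin_map (space V) (tens (space V) (Aq q n)) (coact V) \<and>
    (\<forall>v\<in>carrier (space V). \<forall>M. trilinear_form (space V) (Aq q n) (Aq q n) M \<longrightarrow>
       coact V v (\<lambda>x a. coact V x (\<lambda>y b. M y b a)) =
       coact V v (\<lambda>x a. comult q n a (\<lambda>b c. M x b c))) \<and>
    (\<forall>v\<in>carrier (space V). \<forall>f. linear_form (space V) f \<longrightarrow>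
       coact V v (\<lambda>x a. f x * counit a) = f v)"

definition comodule_hom :: "'k::field \<Rightarrow> nat \<Rightarrow>
    ('k, 'v) comodule \<Rightarrow> ('k, 'w) comodule \<Rightarrow> ('v \<Rightarrow> 'w) \<Rightarrow> bool"
  where "comodule_hom q n V W g \<longleftrightarrow>
    lin_map (space V) (space W) g \<and>
    (\<forall>v\<in>carrier (space V). tens_map (space W) (Aq q n) g (\<lambda>a. a) (coact V v) = coact W (g v))"

definition comodule_iso :: "'k::field \<Rightarrow> nat \<Rightarrow>
    ('k, 'v) comodule \<Rightarrow> ('k, 'w) comodule \<Rightarrow> ('v \<Rightarrow> 'w) \<Rightarrow> bool"
  where "comodule_iso q n V W g \<longleftrightarrow>
    comodule_hom q n V W g \<and> bij_betw g (carrier (space V)) (carrier (space W))"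

text \<open>The coaction on \<open>V \<otimes> W\<close> is \<open>v \<otimes> w \<mapsto> v\<^sub>0 \<otimes> w\<^sub>0 \<otimes> v\<^sub>1 w\<^sub>1\<close>.\<close>

definition tens_comodule :: "'k::field \<Rightarrow> nat \<Rightarrow>
    ('k, 'v) comodule \<Rightarrow> ('k, 'w) comodule \<Rightarrow> ('k, ('k, 'v, 'w) tensor) comodule"
  where "tens_comodule q n V W = \<lparr>
    space = tens (space V) (space W),
    coact = (\<lambda>t B. if bilinear_form (tens (space V) (space W)) (Aq q n) B
      then t (\<lambda>v w. coact V v (\<lambda>x a. coact W w (\<lambda>y b.
        B (pure (space V) (space W) x y) (a \<otimes>\<^bsub>Aq q n\<^esub> b))))
      else 0)\<rparr>"

text \<open>\<open>V\<close> with basis \<open>b 1, \<dots>, b n\<close> is the comodule \<open>V\<^sub>n\<close>.\<close>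

definition is_Vn :: "'k::field \<Rightarrow> nat \<Rightarrow> ('k, 'v) comodule \<Rightarrow> (nat \<Rightarrow> 'v) \<Rightarrow> bool"
  where "is_Vn q n V b \<longleftrightarrow>
    fd_comodule q n V \<and> inj_on b {1..n} \<and> vectorspace.basis class_ring (space V) (b ` {1..n}) \<and>
    (\<forall>i\<in>{1..n}. coact V (b i) =
       (\<lambda>B. \<Sum>j\<in>{1..n}. pure (space V) (Aq q n) (b j) (Aq_gen q n j i) B))"

text \<open>The braiding on the comodules with carrier in a type \<open>'v\<close>: a natural family of comodule
  isomorphisms \<open>V \<otimes> W \<rightarrow> W \<otimes> V\<close> that satisfies both hexagon identities and is \<open>R\<^sub>n\<close>
  on \<open>V\<^sub>n \<otimes> V\<^sub>n\<close>. The carrier of \<open>V \<otimes> W\<close> is not in the type \<open>'v\<close>, so the hexagon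
  identities refer to an arbitrary comodule \<open>T\<close> on \<open>'v\<close> with an isomorphism from the tensor
  product to \<open>T\<close>; they are stated by evaluating both sides on pure tensors and applying them to
  bilinear forms.\<close>

definition braiding :: "'k::field \<Rightarrow> nat \<Rightarrow>
    (('k, 'v) comodule \<Rightarrow> ('k, 'v) comodule \<Rightarrow> ('k, 'v, 'v) tensor \<Rightarrow> ('k, 'v, 'v) tensor) \<Rightarrow> bool"
  where "braiding q n R \<longleftrightarrow>
    (\<forall>V W. fd_comodule q n V \<and> fd_comodule q n W \<longrightarrow>
       comodule_iso q n (tens_comodule q n V W) (tens_comodule q n W V) (R V W)) \<and>
    (\<forall>V W V' W' g h. fd_comodule q n V \<and> fd_comodule q n W \<and> fd_comodule q n V' \<and> fd_comodule q n W' \<and>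
       comodule_hom q n V V' g \<and> comodule_hom q n W W' h \<longrightarrow>
       (\<forall>t\<in>carrier (tens (space V) (space W)).
          R V' W' (tens_map (space V') (space W') g h t) =
          tens_map (space W') (space V') h g (R V W t))) \<and>
    (\<forall>U V W T \<phi>. fd_comodule q n U \<and> fd_comodule q n V \<and> fd_comodule q n W \<and> fd_comodule q n T \<and>
       comodule_iso q n (tens_comodule q n V W) T \<phi> \<longrightarrow>
       (\<forall>v\<in>carrier (space V). \<forall>w\<in>carrier (space W). \<forall>u\<in>carrier (space U).
        \<forall>B. bilinear_form (space U) (space T) B \<longrightarrow>
          R T U (pure (space T) (space U) (\<phi> (pure (space V) (space W) v w)) u) B =
          R W U (pure (space W) (space U) w u) (\<lambda>u' w'.
            R V U (pure (space V) (space U) v u') (\<lambda>u'' v'.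
              B u'' (\<phi> (pure (space V) (space W) v' w')))))) \<and>
    (\<forall>U V W T \<phi>. fd_comodule q n U \<and> fd_comodule q n V \<and> fd_comodule q n W \<and> fd_comodule q n T \<and>
       comodule_iso q n (tens_comodule q n W U) T \<phi> \<longrightarrow>
       (\<forall>v\<in>carrier (space V). \<forall>w\<in>carrier (space W). \<forall>u\<in>carrier (space U).
        \<forall>B. bilinear_form (space T) (space V) B \<longrightarrow>
          R V T (pure (space V) (space T) v (\<phi> (pure (space W) (space U) w u))) B =
          R V W (pure (space V) (space W) v w) (\<lambda>w' v'.
            R V U (pure (space V) (space U) v' u) (\<lambda>u' v''.
              B (\<phi> (pure (space W) (space U) w' u')) v'')))) \<and>
    (\<forall>V b. is_Vn q n V b \<longrightarrow> (\<forall>i\<in>{1..n}. \<forall>j\<in>{1..n}.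
       R V V (pure (space V) (space V) (b i) (b j)) =
       (\<lambda>B. \<Sum>k\<in>{1..n}. \<Sum>l\<in>{1..n}.
          R_entry q k l i j * pure (space V) (space V) (b k) (b l) B)))"


section \<open>Quantum polynomial functors\<close>

text \<open>Objects are comodules over \<open>A\<^sub>q(n,n)\<close> for varying \<open>n\<close>, so \<open>n\<close> is recorded with the
  comodule, and there is one braiding for each \<open>n\<close>.\<close>

type_synonym ('k, 'v) hecke = "nat \<times> ('k, 'v) comodule"

type_synonym ('k, 'v) braidings = "nat \<Rightarrow> ('k, 'v) comodule \<Rightarrow> ('k, 'v) comodule \<Rightarrow>
  ('k, 'v, 'v) tensor \<Rightarrow> ('k, 'v, 'v) tensor"

abbreviation vs :: "('k, 'v) hecke \<Rightarrow> ('k, 'v) module"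
  where "vs V \<equiv> space (snd V)"

definition hecke_pair :: "'k::field \<Rightarrow> nat \<Rightarrow> ('k, 'v) hecke \<Rightarrow> bool"
  where "hecke_pair q e V \<longleftrightarrow> 1 \<le> fst V \<and> fd_comodule q (fst V) (snd V) \<and>
    (\<forall>v\<in>carrier (vs V). coact (snd V) v \<in> vspan functionals
       {pure (vs V) (Aq q (fst V)) x a | x a. x \<in> carrier (vs V) \<and> a \<in> Aq_degree q (fst V) e})"

definition R_self :: "('k, 'v) braidings \<Rightarrow> ('k, 'v) hecke \<Rightarrow>
    ('k, 'v, 'v) tensor \<Rightarrow> ('k, 'v, 'v) tensor"
  where "R_self R V = R (fst V) (snd V) (snd V)"

text \<open>Elements of the braid group are given by words in the letters \<open>(i, True)\<close>, standing for
  \<open>T\<^sub>i\<close>, and \<open>(i, False)\<close>, standing for its inverse.\<close>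

definition braid_words :: "nat \<Rightarrow> (nat \<times> bool) list set"
  where "braid_words d = {w. \<forall>(i, s)\<in>set w. 1 \<le> i \<and> i < d}"

definition braid_letter :: "nat \<Rightarrow> ('k::field, 'v) braidings \<Rightarrow> ('k, 'v) hecke \<Rightarrow>
    nat \<times> bool \<Rightarrow> ('k, 'v) tensors \<Rightarrow> ('k, 'v) tensors"
  where "braid_letter d R V = (\<lambda>(i, s).
    if s then map_at_position d (vs V) (R_self R V) i
    else inv_into (carrier (tens_power d (vs V))) (map_at_position d (vs V) (R_self R V) i))"

definition braid_act :: "nat \<Rightarrow> ('k::field, 'v) braidings \<Rightarrow> ('k, 'v) hecke \<Rightarrow>
    (nat \<times> bool) list \<Rightarrow> ('k, 'v) tensors \<Rightarrow> ('k, 'v) tensors"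
  where "braid_act d R V w = foldr (braid_letter d R V) w"

text \<open>Categories enriched in vector spaces over \<open>'k\<close>; \<open>Comp X Y Z g f\<close> is the composite of
  \<open>f : X \<rightarrow> Y\<close> and \<open>g : Y \<rightarrow> Z\<close>.\<close>

record ('k, 'o, 'm) lin_category =
  Ob :: "'o set"
  Hom :: "'o \<Rightarrow> 'o \<Rightarrow> ('k, 'm) module"
  Comp :: "'o \<Rightarrow> 'o \<Rightarrow> 'o \<Rightarrow> 'm \<Rightarrow> 'm \<Rightarrow> 'm"
  Ident :: "'o \<Rightarrow> 'm"

definition linear_functor :: "('k::field, 'o, 'm) lin_category \<Rightarrow> ('k, 'p, 'l) lin_category \<Rightarrow>
    ('o \<Rightarrow> 'p) \<Rightarrow> ('o \<Rightarrow> 'o \<Rightarrow> 'm \<Rightarrow> 'l) \<Rightarrow> bool"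
  where "linear_functor C D F Fm \<longleftrightarrow>
    (\<forall>X\<in>Ob C. F X \<in> Ob D) \<and>
    (\<forall>X\<in>Ob C. \<forall>Y\<in>Ob C. lin_map (Hom C X Y) (Hom D (F X) (F Y)) (Fm X Y)) \<and>
    (\<forall>X\<in>Ob C. Fm X X (Ident C X) = Ident D (F X)) \<and>
    (\<forall>X\<in>Ob C. \<forall>Y\<in>Ob C. \<forall>Z\<in>Ob C. \<forall>f\<in>carrier (Hom C X Y). \<forall>g\<in>carrier (Hom C Y Z).
       Fm X Z (Comp C X Y Z g f) = Comp D (F X) (F Y) (F Z) (Fm Y Z g) (Fm X Y f))"

text \<open>The space of those linear maps \<open>V \<rightarrow> W\<close> that satisfy \<open>P\<close>, with pointwise operations.
  Morphisms are functions that are \<^const>\<open>undefined\<close> outside of the carrier of \<open>V\<close>.\<close>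

definition hom_space :: "('k::field, 'x) module \<Rightarrow> ('k, 'y) module \<Rightarrow> (('x \<Rightarrow> 'y) \<Rightarrow> bool) \<Rightarrow>
    ('k, 'x \<Rightarrow> 'y) module"
  where "hom_space V W P = \<lparr>
    carrier = {f \<in> extensional (carrier V). lin_map V W f \<and> P f},
    mult = (\<lambda>f g. \<lambda>x\<in>carrier V. \<zero>\<^bsub>W\<^esub>),
    one = (\<lambda>x\<in>carrier V. \<zero>\<^bsub>W\<^esub>),
    zero = (\<lambda>x\<in>carrier V. \<zero>\<^bsub>W\<^esub>),
    add = (\<lambda>f g. \<lambda>x\<in>carrier V. f x \<oplus>\<^bsub>W\<^esub> g x),
    smult = (\<lambda>c f. \<lambda>x\<in>carrier V. c \<odot>\<^bsub>W\<^esub> f x)\<rparr>"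

definition vect_category :: "('k::field, ('k, 'x) module, 'x \<Rightarrow> 'x) lin_category"
  where "vect_category = \<lparr>
    Ob = {V. vspace V \<and> vectorspace.fin_dim class_ring V},
    Hom = (\<lambda>V W. hom_space V W (\<lambda>f. True)),
    Comp = (\<lambda>V W U g f. compose (carrier V) g f),
    Ident = (\<lambda>V. \<lambda>x\<in>carrier V. x)\<rparr>"

definition braid_equivariant :: "nat \<Rightarrow> ('k::field, 'v) braidings \<Rightarrow> ('k, 'v) hecke \<Rightarrow>
    ('k, 'v) hecke \<Rightarrow> (('k, 'v) tensors \<Rightarrow> ('k, 'v) tensors) \<Rightarrow> bool"
  where "braid_equivariant d R V W f \<longleftrightarrow>
    (\<forall>w\<in>braid_words d. \<forall>t\<in>carrier (tens_power d (vs V)).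
       f (braid_act d R V w t) = braid_act d R W w (f t))"

definition Gamma_category :: "'k::field \<Rightarrow> nat \<Rightarrow> nat \<Rightarrow> ('k, 'v) braidings \<Rightarrow>
    ('k, ('k, 'v) hecke, ('k, 'v) tensors \<Rightarrow> ('k, 'v) tensors) lin_category"
  where "Gamma_category q d e R = \<lparr>
    Ob = {V. hecke_pair q e V},
    Hom = (\<lambda>V W. hom_space (tens_power d (vs V)) (tens_power d (vs W)) (braid_equivariant d R V W)),
    Comp = (\<lambda>V W U g f. compose (carrier (tens_power d (vs V))) g f),
    Ident = (\<lambda>V. \<lambda>t\<in>carrier (tens_power d (vs V)). t)\<rparr>"

definition quantum_polynomial_functor :: "'k::field \<Rightarrow> nat \<Rightarrow> nat \<Rightarrow> ('k, 'v) braidings \<Rightarrow>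
    (('k, 'v) hecke \<Rightarrow> ('k, 'x) module) \<Rightarrow>
    (('k, 'v) hecke \<Rightarrow> ('k, 'v) hecke \<Rightarrow> (('k, 'v) tensors \<Rightarrow> ('k, 'v) tensors) \<Rightarrow> 'x \<Rightarrow> 'x) \<Rightarrow> bool"
  where "quantum_polynomial_functor q d e R F Fm \<longleftrightarrow>
    linear_functor (Gamma_category q d e R) vect_category F Fm"


section \<open>Quantum symmetric, exterior and divided powers\<close>

definition gen_eigenspace :: "('k::field, 'v) module \<Rightarrow> ('v \<Rightarrow> 'v) \<Rightarrow> 'k \<Rightarrow> 'v set"
  where "gen_eigenspace V f c = {w \<in> carrier V. \<forall>\<^sub>F N in sequentially.
    ((\<lambda>x. f x \<ominus>\<^bsub>V\<^esub> c \<odot>\<^bsub>V\<^esub> x) ^^ N) w = \<zero>\<^bsub>V\<^esub>}"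

definition Lambda2 :: "'k::field \<Rightarrow> ('k, 'v) braidings \<Rightarrow> ('k, 'v) hecke \<Rightarrow> ('k, 'v, 'v) tensor set"
  where "Lambda2 q R V = vspan (tens (vs V) (vs V))
    (\<Union>i::int. gen_eigenspace (tens (vs V) (vs V)) (R_self R V) (- (q powi i)))"

definition Gamma2 :: "'k::field \<Rightarrow> ('k, 'v) braidings \<Rightarrow> ('k, 'v) hecke \<Rightarrow> ('k, 'v, 'v) tensor set"
  where "Gamma2 q R V = vspan (tens (vs V) (vs V))
    (\<Union>i::int. gen_eigenspace (tens (vs V) (vs V)) (R_self R V) (q powi i))"

definition S_relations :: "'k::field \<Rightarrow> nat \<Rightarrow> ('k, 'v) braidings \<Rightarrow> ('k, 'v) hecke \<Rightarrow>
    ('k, 'v) tensors set"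
  where "S_relations q d R V =
    vspan (tens_power d (vs V)) (\<Union>i\<in>{1..<d}. at_position d (vs V) i (Lambda2 q R V))"

definition S_power :: "'k::field \<Rightarrow> nat \<Rightarrow> ('k, 'v) braidings \<Rightarrow> ('k, 'v) hecke \<Rightarrow>
    ('k, ('k, 'v) tensors set) module"
  where "S_power q d R V = quot_space (tens_power d (vs V)) (S_relations q d R V)"

definition Lambda_power :: "'k::field \<Rightarrow> nat \<Rightarrow> ('k, 'v) braidings \<Rightarrow> ('k, 'v) hecke \<Rightarrow>
    ('k, ('k, 'v) tensors) module"
  where "Lambda_power q d R V = (tens_power d (vs V))\<lparr>carrier :=
    carrier (tens_power d (vs V)) \<inter> (\<Inter>i\<in>{1..<d}. at_position d (vs V) i (Lambda2 q R V))\<rparr>"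

definition Gamma_power :: "'k::field \<Rightarrow> nat \<Rightarrow> ('k, 'v) braidings \<Rightarrow> ('k, 'v) hecke \<Rightarrow>
    ('k, ('k, 'v) tensors) module"
  where "Gamma_power q d R V = (tens_power d (vs V))\<lparr>carrier :=
    carrier (tens_power d (vs V)) \<inter> (\<Inter>i\<in>{1..<d}. at_position d (vs V) i (Gamma2 q R V))\<rparr>"

text \<open>The map induced by \<open>f\<close> on the quotients: \<open>[x] \<mapsto> [f x]\<close>. The value is a coset only if \<open>f\<close>
  respects the relations.\<close>

definition S_map :: "'k::field \<Rightarrow> nat \<Rightarrow> ('k, 'v) braidings \<Rightarrow> ('k, 'v) hecke \<Rightarrow> ('k, 'v) hecke \<Rightarrow>
    (('k, 'v) tensors \<Rightarrow> ('k, 'v) tensors) \<Rightarrow> ('k, 'v) tensors set \<Rightarrow> ('k, 'v) tensors set"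
  where "S_map q d R V W f =
    (\<lambda>C\<in>carrier (S_power q d R V). S_relations q d R W <+>\<^bsub>tens_power d (vs W)\<^esub> f ` C)"

definition Lambda_map :: "'k::field \<Rightarrow> nat \<Rightarrow> ('k, 'v) braidings \<Rightarrow> ('k, 'v) hecke \<Rightarrow> ('k, 'v) hecke \<Rightarrow>
    (('k, 'v) tensors \<Rightarrow> ('k, 'v) tensors) \<Rightarrow> ('k, 'v) tensors \<Rightarrow> ('k, 'v) tensors"
  where "Lambda_map q d R V W f = restrict f (carrier (Lambda_power q d R V))"

definition Gamma_map :: "'k::field \<Rightarrow> nat \<Rightarrow> ('k, 'v) braidings \<Rightarrow> ('k, 'v) hecke \<Rightarrow> ('k, 'v) hecke \<Rightarrow>
    (('k, 'v) tensors \<Rightarrow> ('k, 'v) tensors) \<Rightarrow> ('k, 'v) tensors \<Rightarrow> ('k, 'v) tensors"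
  where "Gamma_map q d R V W f = restrict f (carrier (Gamma_power q d R V))"

end

theory Submission
  imports Defs "HOL-Library.Function_Algebras"
begin

text \<open>A morphism \<open>f : V\<^sup>\<otimes>\<^sup>d \<rightarrow> W\<^sup>\<otimes>\<^sup>d\<close> commutes with every \<open>T\<^sub>i\<close>, hence with
  \<open>T\<^sub>i - c\<close> for every scalar \<open>c\<close>, and so it maps the generalized eigenspaces of \<open>T\<^sub>i\<close> on
  the source into those on the target. On the other hand, the subspace
  \<open>V \<otimes> \<dots> \<otimes> \<Lambda>\<^sup>2(V) \<otimes> \<dots> \<otimes> V\<close>, with \<open>\<Lambda>\<^sup>2\<close> in positions \<open>i, i + 1\<close>, is the sum of the
  generalized eigenspaces of \<open>T\<^sub>i\<close> for the eigenvalues \<open>- q\<^sup>j\<close>; for \<open>\<Gamma>\<^sup>2\<close> the eigenvalues are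
  \<open>q\<^sup>j\<close>. Therefore \<open>f\<close> preserves these subspaces (\<open>image_at_position_gen_eigensum\<close>), as well as
  their sums and intersections over \<open>i\<close>, and passing to quotients or subspaces is functorial
  (\<open>quotient_functor\<close>, \<open>restriction_functor\<close>).

  The step with content is that a generalized eigenvector \<open>t\<close> of \<open>T\<^sub>i = 1 \<otimes> R \<otimes> 1\<close> lies in
  \<open>V \<otimes> \<dots> \<otimes> E \<otimes> \<dots> \<otimes> V\<close> with \<open>E\<close> the generalized eigenspace of \<open>R\<close>: tensoring with \<open>V\<close>
  preserves kernels. Let \<open>g = (R - c)\<^sup>N\<close> with \<open>(1 \<otimes> g \<otimes> 1) t = 0\<close>, and choose a linear \<open>s\<close> with
  \<open>g s g = g\<close> (\<open>generalized_inverse\<close>). Then \<open>h = 1 - s g\<close> has its image in the kernel of \<open>g\<close>.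
  As \<open>f \<mapsto> 1 \<otimes> f \<otimes> 1\<close> is compatible with composition and differences,
  \<open>t = (1 \<otimes> h \<otimes> 1) t\<close>, which lies in \<open>V \<otimes> \<dots> \<otimes> ker g \<otimes> \<dots> \<otimes> V\<close>
  (\<open>gen_eigenspace_map_at_position\<close>).

  The same compatibility shows that \<open>T\<^sub>i\<close> is bijective because \<open>R\<close> is; hence every braid acts
  linearly, which makes the equivariant maps a vector space.\<close>

section \<open>Vector spaces\<close>

lemma vspaceI:
  fixes V :: "('k::field, 'v) module"
  assumes "\<zero>\<^bsub>V\<^esub> \<in> carrier V"
    and "\<And>x y. x \<in> carrier V \<Longrightarrow> y \<in> carrier V \<Longrightarrow> x \<oplus>\<^bsub>V\<^esub> y \<in> carrier V"
    and "\<And>c x. x \<in> carrier V \<Longrightarrow> c \<odot>\<^bsub>V\<^esub> x \<in> carrier V"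
    and "\<And>x. x \<in> carrier V \<Longrightarrow> \<exists>y\<in>carrier V. x \<oplus>\<^bsub>V\<^esub> y = \<zero>\<^bsub>V\<^esub>"
    and "\<And>x y. x \<in> carrier V \<Longrightarrow> y \<in> carrier V \<Longrightarrow> x \<oplus>\<^bsub>V\<^esub> y = y \<oplus>\<^bsub>V\<^esub> x"
    and "\<And>x y z. x \<in> carrier V \<Longrightarrow> y \<in> carrier V \<Longrightarrow> z \<in> carrier V \<Longrightarrow>
      (x \<oplus>\<^bsub>V\<^esub> y) \<oplus>\<^bsub>V\<^esub> z = x \<oplus>\<^bsub>V\<^esub> (y \<oplus>\<^bsub>V\<^esub> z)"
    and "\<And>x. x \<in> carrier V \<Longrightarrow> x \<oplus>\<^bsub>V\<^esub> \<zero>\<^bsub>V\<^esub> = x"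
    and "\<And>a b x. x \<in> carrier V \<Longrightarrow> (a * b) \<odot>\<^bsub>V\<^esub> x = a \<odot>\<^bsub>V\<^esub> (b \<odot>\<^bsub>V\<^esub> x)"
    and "\<And>x. x \<in> carrier V \<Longrightarrow> 1 \<odot>\<^bsub>V\<^esub> x = x"
    and "\<And>a b x. x \<in> carrier V \<Longrightarrow> (a + b) \<odot>\<^bsub>V\<^esub> x = a \<odot>\<^bsub>V\<^esub> x \<oplus>\<^bsub>V\<^esub> b \<odot>\<^bsub>V\<^esub> x"
    and "\<And>a x y. x \<in> carrier V \<Longrightarrow> y \<in> carrier V \<Longrightarrow>
      a \<odot>\<^bsub>V\<^esub> (x \<oplus>\<^bsub>V\<^esub> y) = a \<odot>\<^bsub>V\<^esub> x \<oplus>\<^bsub>V\<^esub> a \<odot>\<^bsub>V\<^esub> y"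
  shows "vspace V"
proof (rule vs_criteria[OF class_field], goal_cases)
  case 3
  then show ?case using assms(4) by blast
qed (auto intro: assms(1-3) assms(5-11))

lemma lin_mapI:
  assumes "vspace V" and "vspace W"
    and "\<And>x. x \<in> carrier V \<Longrightarrow> f x \<in> carrier W"
    and "\<And>x y. x \<in> carrier V \<Longrightarrow> y \<in> carrier V \<Longrightarrow> f (x \<oplus>\<^bsub>V\<^esub> y) = f x \<oplus>\<^bsub>W\<^esub> f y"
    and "\<And>c x. x \<in> carrier V \<Longrightarrow> f (c \<odot>\<^bsub>V\<^esub> x) = c \<odot>\<^bsub>W\<^esub> f x"
  shows "lin_map V W f"
proof -
  have "f \<in> LinearCombinations.module_hom class_ring V W"
    unfolding LinearCombinations.module_hom_def using assms(3-5) by simp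
  then show ?thesis
    using assms(1,2)
    unfolding linear_map_def mod_hom_def mod_hom_axioms_def vectorspace_def by blast
qed

lemma lin_mapD:
  assumes "lin_map V W f"
  shows "vspace V" "vspace W"
    "\<And>x. x \<in> carrier V \<Longrightarrow> f x \<in> carrier W"
    "\<And>x y. x \<in> carrier V \<Longrightarrow> y \<in> carrier V \<Longrightarrow> f (x \<oplus>\<^bsub>V\<^esub> y) = f x \<oplus>\<^bsub>W\<^esub> f y"
    "\<And>c x. x \<in> carrier V \<Longrightarrow> f (c \<odot>\<^bsub>V\<^esub> x) = c \<odot>\<^bsub>W\<^esub> f x"
    "f \<zero>\<^bsub>V\<^esub> = \<zero>\<^bsub>W\<^esub>"
    "\<And>x y. x \<in> carrier V \<Longrightarrow> y \<in> carrier V \<Longrightarrow> f (x \<ominus>\<^bsub>V\<^esub> y) = f x \<ominus>\<^bsub>W\<^esub> f y"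
proof -
  interpret linear_map class_ring V W f by fact
  show "vspace V" by (rule V.vectorspace_axioms)
  show "vspace W" by (rule W.vectorspace_axioms)
  show "\<And>x. x \<in> carrier V \<Longrightarrow> f x \<in> carrier W"
    by (rule f_im)
  show "\<And>x y. x \<in> carrier V \<Longrightarrow> y \<in> carrier V \<Longrightarrow> f (x \<oplus>\<^bsub>V\<^esub> y) = f x \<oplus>\<^bsub>W\<^esub> f y"
    by (rule f_add)
  show "\<And>c x. x \<in> carrier V \<Longrightarrow> f (c \<odot>\<^bsub>V\<^esub> x) = c \<odot>\<^bsub>W\<^esub> f x"
    by (rule f_smult) simp
  show "f \<zero>\<^bsub>V\<^esub> = \<zero>\<^bsub>W\<^esub>" by (rule f0_is_0)
  show "\<And>x y. x \<in> carrier V \<Longrightarrow> y \<in> carrier V \<Longrightarrow> f (x \<ominus>\<^bsub>V\<^esub> y) = f x \<ominus>\<^bsub>W\<^esub> f y"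
    by (rule f_minus)
qed

definition vsubspace :: "('k::field, 'v) module \<Rightarrow> 'v set \<Rightarrow> bool"
  where "vsubspace V L \<longleftrightarrow> VectorSpace.subspace class_ring L V"

lemma vsubspaceI:
  assumes "vspace V" and "L \<subseteq> carrier V" and "\<zero>\<^bsub>V\<^esub> \<in> L"
    and "\<And>x y. x \<in> L \<Longrightarrow> y \<in> L \<Longrightarrow> x \<oplus>\<^bsub>V\<^esub> y \<in> L"
    and "\<And>c x. x \<in> L \<Longrightarrow> c \<odot>\<^bsub>V\<^esub> x \<in> L"
  shows "vsubspace V L"
  using assms unfolding vsubspace_def VectorSpace.subspace_def submodule_def vectorspace_def by auto

lemma vsubspaceD:
  assumes "vsubspace V L"
  shows "vspace V" and "L \<subseteq> carrier V" and "\<zero>\<^bsub>V\<^esub> \<in> L"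
    and "\<And>x y. x \<in> L \<Longrightarrow> y \<in> L \<Longrightarrow> x \<oplus>\<^bsub>V\<^esub> y \<in> L"
    and "\<And>c x. x \<in> L \<Longrightarrow> c \<odot>\<^bsub>V\<^esub> x \<in> L"
  using assms unfolding vsubspace_def VectorSpace.subspace_def submodule_def by auto

lemma vsubspace_Inter:
  assumes V: "vspace V" and L: "\<And>i. vsubspace V (L i)"
  shows "vsubspace V (carrier V \<inter> (\<Inter>i\<in>I. L i))"
proof -
  interpret V: vectorspace class_ring V by fact
  have "c \<odot>\<^bsub>V\<^esub> x \<in> carrier V" if "x \<in> carrier V" for c x
    using that by (intro V.smult_closed) auto
  then show ?thesis
    by (intro vsubspaceI[OF V]) (use vsubspaceD(3-5)[OF L] in auto)
qed

lemma vspace_vsubspace: "vsubspace V L \<Longrightarrow> vspace (V\<lparr>carrier := L\<rparr>)"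
  unfolding vsubspace_def by (metis VectorSpace.subspace_def vectorspace.subspace_is_vs)

lemma vsubspace_span: "vspace V \<Longrightarrow> S \<subseteq> carrier V \<Longrightarrow> vsubspace V (vspan V S)"
  unfolding vsubspace_def by (rule vectorspace.span_is_subspace)

lemma span_least: "vsubspace V L \<Longrightarrow> S \<subseteq> L \<Longrightarrow> vspan V S \<subseteq> L"
  unfolding vsubspace_def VectorSpace.subspace_def
  by (meson module.span_is_subset submodule_def)

lemma subset_span: "vspace V \<Longrightarrow> S \<subseteq> carrier V \<Longrightarrow> S \<subseteq> vspan V S"
  by (meson module.in_own_span vectorspace_def)

lemma span_induct [consumes 3, case_names base zero add smult]:
  assumes V: "vspace V" "S \<subseteq> carrier V" and x: "x \<in> vspan V S"
    and P: "\<And>x. x \<in> S \<Longrightarrow> P x" "P \<zero>\<^bsub>V\<^esub>"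
      "\<And>x y. x \<in> vspan V S \<Longrightarrow> y \<in> vspan V S \<Longrightarrow> P x \<Longrightarrow> P y \<Longrightarrow> P (x \<oplus>\<^bsub>V\<^esub> y)"
      "\<And>c x. x \<in> vspan V S \<Longrightarrow> P x \<Longrightarrow> P (c \<odot>\<^bsub>V\<^esub> x)"
  shows "P x"
proof -
  note L = vsubspaceD[OF vsubspace_span[OF V]]
  have "vsubspace V {x \<in> vspan V S. P x}"
    by (rule vsubspaceI[OF V(1)]) (use L P in auto)
  then have "vspan V S \<subseteq> {x \<in> vspan V S. P x}"
    by (rule span_least) (use subset_span[OF V] P in auto)
  then show ?thesis using x by auto
qed

lemma lin_map_span:
  assumes f: "lin_map V W f" and S: "S \<subseteq> carrier V" and L: "vsubspace W L"
    and im: "f ` S \<subseteq> L"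
  shows "f ` vspan V S \<subseteq> L"
proof -
  note fD = lin_mapD[OF f]
  have "f x \<in> L" if "x \<in> vspan V S" for x
    using fD(1) S that
  proof (induction rule: span_induct)
    case (base x)
    then show ?case using im by auto
  next
    case zero
    then show ?case using fD vsubspaceD[OF L] by auto
  next
    case (add x y)
    moreover have "x \<in> carrier V" "y \<in> carrier V"
      using add vsubspaceD(2)[OF vsubspace_span[OF fD(1) S]] by auto
    ultimately show ?case using fD vsubspaceD[OF L] by auto
  next
    case (smult c x)
    moreover have "x \<in> carrier V"
      using smult vsubspaceD(2)[OF vsubspace_span[OF fD(1) S]] by auto
    ultimately show ?case using fD vsubspaceD[OF L] by auto
  qed
  then show ?thesis by auto
qed

lemma fin_dim_iff:
  assumes "vspace V"
  shows "vectorspace.fin_dim class_ring V \<longleftrightarrow> (\<exists>A. finite A \<and> A \<subseteq> carrier V \<and> vspan V A = carrier V)"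
  using vectorspace.fin_dim_def[OF assms] .

text \<open>A linearly independent subset of the subspace is one of the ambient space, so its size is
  bounded; a maximal one is a finite generating set.\<close>

lemma fin_dim_vsubspace:
  assumes L: "vsubspace V L" and fd: "vectorspace.fin_dim class_ring V"
  shows "vectorspace.fin_dim class_ring (V\<lparr>carrier := L\<rparr>)"
proof -
  interpret V: vectorspace class_ring V by (rule vsubspaceD[OF L])
  interpret L: vectorspace class_ring "V\<lparr>carrier := L\<rparr>" by (rule vspace_vsubspace[OF L])
  have sm: "submodule class_ring L V" using L by (simp add: vsubspace_def)
  have li: "finite A \<and> card A \<le> V.dim" if "A \<subseteq> L" "L.lin_indpt A" for A
    using V.li_le_dim[OF fd, of A] that V.span_li_not_depend(2)[OF _ sm, of A] vsubspaceD(2)[OF L]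
    by auto
  have "\<exists>A. finite A \<and> maximal A (\<lambda>S. S \<subseteq> carrier (V\<lparr>carrier := L\<rparr>) \<and> L.lin_indpt S)"
    by (rule maximal_exists[where N = "V.dim" and B = "{}"])
      (use li L.finite_lin_indpt2[of "{}"] in auto)
  then obtain A where A: "finite A" "maximal A (\<lambda>S. S \<subseteq> carrier (V\<lparr>carrier := L\<rparr>) \<and> L.lin_indpt S)"
    by blast
  then have "L.gen_set A" by (intro L.max_li_is_gen)
  with A show ?thesis unfolding L.fin_dim_def maximal_def by blast
qed

lemma fin_dim_image:
  assumes "lin_map V W f" and "f ` carrier V = carrier W"
    and "vectorspace.fin_dim class_ring V"
  shows "vectorspace.fin_dim class_ring W"
  using assms linear_map.rank_nullity_main(2) by blast

section \<open>Spaces of functionals and tensor products\<close>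

lemma functionals_simps [simp]:
  "carrier functionals = UNIV"
  "\<zero>\<^bsub>functionals\<^esub> = (\<lambda>_. 0)"
  "f \<oplus>\<^bsub>functionals\<^esub> g = (\<lambda>x. f x + g x)"
  "c \<odot>\<^bsub>functionals\<^esub> f = (\<lambda>x. c * f x)"
  by (simp_all add: ring.func_space_def[OF class_ring.ring_axioms] restrict_def)

text \<open>Vector spaces of scalar-valued functions with pointwise operations. Both kinds of tensor
  spaces have this form, so that identities of tensors become pointwise identities of scalars.\<close>

definition fun_vspace :: "('k::field, 'i \<Rightarrow> 'k) module \<Rightarrow> bool"
  where "fun_vspace U \<longleftrightarrow> (\<exists>L. vsubspace functionals L \<and> U = functionals\<lparr>carrier := L\<rparr>)"

lemma vspace_functionals: "vspace (functionals :: ('k::field, 'i \<Rightarrow> 'k) module)"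
proof (rule vspaceI)
  fix x :: "'i \<Rightarrow> 'k"
  have "x \<oplus>\<^bsub>functionals\<^esub> (\<lambda>i. - x i) = \<zero>\<^bsub>functionals\<^esub>"
    by simp
  then show "\<exists>y\<in>carrier functionals. x \<oplus>\<^bsub>functionals\<^esub> y = \<zero>\<^bsub>functionals\<^esub>"
    by (metis UNIV_I functionals_simps(1))
qed (simp_all add: algebra_simps)

lemma fun_vspaceD:
  assumes "fun_vspace U"
  shows "vspace U" "\<zero>\<^bsub>U\<^esub> = (\<lambda>_. 0)" "f \<oplus>\<^bsub>U\<^esub> g = (\<lambda>x. f x + g x)" "c \<odot>\<^bsub>U\<^esub> f = (\<lambda>x. c * f x)"
    "vsubspace functionals (carrier U)"
  using assms vspace_vsubspace unfolding fun_vspace_def by auto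

lemma fun_vspace_minus:
  assumes U: "fun_vspace U" and xy: "x \<in> carrier U" "y \<in> carrier U"
  shows "x \<ominus>\<^bsub>U\<^esub> y = (\<lambda>i. x i - y i)"
proof -
  note UD = fun_vspaceD[OF U]
  interpret U: vectorspace class_ring U by (rule UD)
  have m: "(-1) \<odot>\<^bsub>U\<^esub> y \<in> carrier U" using xy by (intro U.smult_closed) auto
  have "((-1) \<odot>\<^bsub>U\<^esub> y) \<oplus>\<^bsub>U\<^esub> y = \<zero>\<^bsub>U\<^esub>" by (simp add: UD)
  then have "\<ominus>\<^bsub>U\<^esub> y = (-1) \<odot>\<^bsub>U\<^esub> y" using m xy by (intro U.minus_equality)
  then show ?thesis unfolding a_minus_def by (simp add: UD)
qed

lemma fun_vspace_tens: "fun_vspace (tens V W)"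
  unfolding fun_vspace_def tens_def using vsubspace_span[OF vspace_functionals] by auto

lemma fun_vspace_tens_power: "fun_vspace (tens_power d V)"
  unfolding fun_vspace_def tens_power_def using vsubspace_span[OF vspace_functionals] by auto

lemmas tens_simps [simp] = fun_vspaceD(2-4)[OF fun_vspace_tens] fun_vspaceD(2-4)[OF fun_vspace_tens_power]

lemmas vspace_tens = fun_vspaceD(1)[OF fun_vspace_tens]
lemmas vspace_tens_power = fun_vspaceD(1)[OF fun_vspace_tens_power]

lemma tens_power_closed:
  shows "(\<lambda>_. 0) \<in> carrier (tens_power d V)"
    and "s \<in> carrier (tens_power d V) \<Longrightarrow> t \<in> carrier (tens_power d V) \<Longrightarrow>
      (\<lambda>M. s M + t M) \<in> carrier (tens_power d V)"
    and "s \<in> carrier (tens_power d V) \<Longrightarrow> (\<lambda>M. c * s M) \<in> carrier (tens_power d V)"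
  using vsubspaceD(3-5)[OF fun_vspaceD(5)[OF fun_vspace_tens_power]] by auto

lemma pure_closed: "x \<in> carrier V \<Longrightarrow> y \<in> carrier W \<Longrightarrow> pure V W x y \<in> carrier (tens V W)"
  using subset_span[OF vspace_functionals, of "{pure V W x y | x y. x \<in> carrier V \<and> y \<in> carrier W}"]
  unfolding tens_def by auto

lemma pure_power_closed:
  "set xs \<subseteq> carrier V \<Longrightarrow> length xs = d \<Longrightarrow> pure_power d V xs \<in> carrier (tens_power d V)"
  using subset_span[OF vspace_functionals,
      of "{pure_power d V xs | xs. set xs \<subseteq> carrier V \<and> length xs = d}"]
  unfolding tens_power_def by auto

lemma tens_induct [consumes 1, case_names pure zero add smult]:
  assumes t: "t \<in> carrier (tens V W)"
    and "\<And>x y. x \<in> carrier V \<Longrightarrow> y \<in> carrier W \<Longrightarrow> P (pure V W x y)"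
    and "P (\<lambda>_. 0)"
    and "\<And>s t. s \<in> carrier (tens V W) \<Longrightarrow> t \<in> carrier (tens V W) \<Longrightarrow> P s \<Longrightarrow> P t \<Longrightarrow> P (\<lambda>B. s B + t B)"
    and "\<And>c t. t \<in> carrier (tens V W) \<Longrightarrow> P t \<Longrightarrow> P (\<lambda>B. c * t B)"
  shows "P t"
proof -
  have c: "carrier (tens V W) = vspan functionals {pure V W x y | x y. x \<in> carrier V \<and> y \<in> carrier W}"
    by (simp add: tens_def)
  show ?thesis
  proof (rule span_induct[OF vspace_functionals _ t[unfolded c]], unfold c[symmetric] functionals_simps)
    show "P (\<lambda>_. 0)" by (rule assms(3))
    show "P (\<lambda>i. x i + y i)" if "x \<in> carrier (tens V W)" "y \<in> carrier (tens V W)" "P x" "P y" for x y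
      using assms(4) that .
    show "P (\<lambda>i. a * x i)" if "x \<in> carrier (tens V W)" "P x" for a x
      using assms(5) that .
  qed (use assms(2) in auto)
qed

lemma tens_power_induct [consumes 1, case_names pure zero add smult]:
  assumes t: "t \<in> carrier (tens_power d V)"
    and "\<And>xs. set xs \<subseteq> carrier V \<Longrightarrow> length xs = d \<Longrightarrow> P (pure_power d V xs)"
    and "P (\<lambda>_. 0)"
    and "\<And>s t. s \<in> carrier (tens_power d V) \<Longrightarrow> t \<in> carrier (tens_power d V) \<Longrightarrow> P s \<Longrightarrow> P t \<Longrightarrow>
      P (\<lambda>M. s M + t M)"
    and "\<And>c t. t \<in> carrier (tens_power d V) \<Longrightarrow> P t \<Longrightarrow> P (\<lambda>M. c * t M)"
  shows "P t"
proof -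
  have c: "carrier (tens_power d V) =
      vspan functionals {pure_power d V xs | xs. set xs \<subseteq> carrier V \<and> length xs = d}"
    by (simp add: tens_power_def)
  show ?thesis
  proof (rule span_induct[OF vspace_functionals _ t[unfolded c]], unfold c[symmetric] functionals_simps)
    show "P (\<lambda>_. 0)" by (rule assms(3))
    show "P (\<lambda>i. x i + y i)" if "x \<in> carrier (tens_power d V)" "y \<in> carrier (tens_power d V)" "P x" "P y" for x y
      using assms(4) that .
    show "P (\<lambda>i. a * x i)" if "x \<in> carrier (tens_power d V)" "P x" for a x
      using assms(5) that .
  qed (use assms(2) in auto)
qed

lemma list_split_at:
  assumes "length zs = d" "1 \<le> i" "i < d"
  obtains ls a b rs where "zs = ls @ [a, b] @ rs" "length ls + 1 = i" "i + 1 + length rs = d"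
proof
  have "drop (i - 1) zs = zs ! (i - 1) # drop i zs"
    using Cons_nth_drop_Suc[of "i - 1" zs] assms by simp
  moreover have "drop i zs = zs ! i # drop (i + 1) zs"
    using Cons_nth_drop_Suc[of i zs] assms by simp
  ultimately show "zs = take (i - 1) zs @ [zs ! (i - 1), zs ! i] @ drop (i + 1) zs"
    using append_take_drop_id[of "i - 1" zs] by simp
qed (use assms in auto)

text \<open>Induction for the tensor power in which a pure tensor comes already split around the
  positions \<open>i, i + 1\<close>.\<close>

lemma tens_power_induct_at [consumes 3, case_names pure zero add smult]:
  assumes t: "t \<in> carrier (tens_power d V)" and i: "1 \<le> i" "i < d"
    and base: "\<And>ls a b rs. set ls \<subseteq> carrier V \<Longrightarrow> a \<in> carrier V \<Longrightarrow> b \<in> carrier V \<Longrightarrow>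
      set rs \<subseteq> carrier V \<Longrightarrow> length ls + 1 = i \<Longrightarrow> i + 1 + length rs = d \<Longrightarrow>
      P (pure_power d V (ls @ [a, b] @ rs))"
    and "P (\<lambda>_. 0)"
    and "\<And>s t. s \<in> carrier (tens_power d V) \<Longrightarrow> t \<in> carrier (tens_power d V) \<Longrightarrow> P s \<Longrightarrow> P t \<Longrightarrow>
      P (\<lambda>M. s M + t M)"
    and "\<And>c t. t \<in> carrier (tens_power d V) \<Longrightarrow> P t \<Longrightarrow> P (\<lambda>M. c * t M)"
  shows "P t"
  using t
proof (induction rule: tens_power_induct)
  case (pure xs)
  obtain ls a b rs where "xs = ls @ [a, b] @ rs" "length ls + 1 = i" "i + 1 + length rs = d"
    using list_split_at[OF pure(2) i] .
  then show ?case using base[of ls a b rs] pure(1) by auto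
qed fact+

lemma multilinear_formD:
  "multilinear_form d V M \<Longrightarrow> set xs \<subseteq> carrier V \<Longrightarrow> set ys \<subseteq> carrier V \<Longrightarrow>
    length xs + 1 + length ys = d \<Longrightarrow> linear_form V (\<lambda>x. M (xs @ x # ys))"
  unfolding multilinear_form_def by blast

lemma bilinear_slice:
  assumes M: "multilinear_form d V M" and "set ls \<subseteq> carrier V" "set rs \<subseteq> carrier V"
    and "length ls + 2 + length rs = d"
  shows "bilinear_form V V (\<lambda>x y. M (ls @ [x, y] @ rs))"
  unfolding bilinear_form_def
proof (intro conjI ballI)
  show "linear_form V (\<lambda>y. M (ls @ [x, y] @ rs))" if "x \<in> carrier V" for x
    using multilinear_formD[OF M, of "ls @ [x]" rs] that assms by simp
  show "linear_form V (\<lambda>x. M (ls @ [x, y] @ rs))" if "y \<in> carrier V" for y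
    using multilinear_formD[OF M, of ls "y # rs"] that assms by simp
qed

lemma pure_add:
  assumes "x \<in> carrier V" "x' \<in> carrier V" "y \<in> carrier W"
  shows "pure V W (x \<oplus>\<^bsub>V\<^esub> x') y = (\<lambda>B. pure V W x y B + pure V W x' y B)"
  using assms by (auto simp: pure_def bilinear_form_def linear_form_def)

lemma pure_smult:
  assumes "x \<in> carrier V" "y \<in> carrier W"
  shows "pure V W (c \<odot>\<^bsub>V\<^esub> x) y = (\<lambda>B. c * pure V W x y B)"
  using assms by (auto simp: pure_def bilinear_form_def linear_form_def)

lemma pure_add_right:
  assumes "x \<in> carrier V" "y \<in> carrier W" "y' \<in> carrier W"
  shows "pure V W x (y \<oplus>\<^bsub>W\<^esub> y') = (\<lambda>B. pure V W x y B + pure V W x y' B)"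
  using assms by (auto simp: pure_def bilinear_form_def linear_form_def)

lemma pure_smult_right:
  assumes "x \<in> carrier V" "y \<in> carrier W"
  shows "pure V W x (c \<odot>\<^bsub>W\<^esub> y) = (\<lambda>B. c * pure V W x y B)"
  using assms by (auto simp: pure_def bilinear_form_def linear_form_def)

section \<open>Maps at a position\<close>

lemma pure_insert_pure:
  assumes "set ls \<subseteq> carrier V" "set rs \<subseteq> carrier V" "length ls + 2 + length rs = d"
  shows "pure_insert d V ls (pure V V a b) rs = pure_power d V (ls @ [a, b] @ rs)"
  using bilinear_slice[OF _ assms] by (auto simp: pure_insert_def pure_def pure_power_def)

lemma lin_map_pure_insert:
  assumes "set ls \<subseteq> carrier V" "set rs \<subseteq> carrier V" "length ls + 2 + length rs = d"
  shows "lin_map (tens V V) (tens_power d V) (\<lambda>w. pure_insert d V ls w rs)"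
proof (rule lin_mapI[OF vspace_tens vspace_tens_power])
  fix w assume "w \<in> carrier (tens V V)"
  then show "pure_insert d V ls w rs \<in> carrier (tens_power d V)"
  proof (induction rule: tens_induct)
    case (pure x y)
    then show ?case using assms by (simp add: pure_insert_pure) (intro pure_power_closed, auto)
  next
    case zero
    then show ?case using tens_power_closed(1)[of d V] by (simp add: pure_insert_def)
  next
    case (add s t)
    have "pure_insert d V ls (\<lambda>B. s B + t B) rs =
        (\<lambda>M. pure_insert d V ls s rs M + pure_insert d V ls t rs M)"
      by (auto simp: pure_insert_def)
    then show ?case using tens_power_closed(2)[OF add(3,4)] by simp
  next
    case (smult c t)
    have "pure_insert d V ls (\<lambda>B. c * t B) rs = (\<lambda>M. c * pure_insert d V ls t rs M)"
      by (auto simp: pure_insert_def)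
    then show ?case using tens_power_closed(3)[OF smult(2)] by simp
  qed
qed (auto simp: pure_insert_def)

text \<open>A tensor \<open>w\<close> is a functional on bilinear forms; applied to a family of forms that depends
  linearly on a parameter, it gives a linear form in the parameter. This is clear for pure tensors
  and is inherited by linear combinations.\<close>

lemma linear_form_slice:
  assumes "w \<in> carrier (tens V V)"
    and "\<And>x y. x \<in> carrier V \<Longrightarrow> y \<in> carrier V \<Longrightarrow> linear_form V (\<lambda>u. F u x y)"
    and bil: "\<And>u. u \<in> carrier V \<Longrightarrow> bilinear_form V V (F u)" and V: "vspace V"
  shows "linear_form V (\<lambda>u. w (F u))"
  using assms(1)
proof (induction rule: tens_induct)
  case (pure x y)
  interpret V: vectorspace class_ring V by fact
  show ?case using assms(2)[OF pure] bil by (auto simp: linear_form_def pure_def)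
qed (auto simp: linear_form_def algebra_simps)

text \<open>A tensor vanishes by convention on functions that are not multilinear, so evaluating
  \<^const>\<open>map_at_position\<close> needs the pulled back function to be multilinear. In the slots
  \<open>i\<close> and \<open>i + 1\<close> this comes from the linearity of \<open>f\<close>, in the other slots from the
  multilinearity of \<open>M\<close>.\<close>

lemma multilinear_form_map_at_position:
  assumes f: "lin_map (tens V V) (tens V V) f" and M: "multilinear_form d V M"
    and i: "1 \<le> i" "i < d" and V: "vspace V"
  shows "multilinear_form d V
    (\<lambda>xs. f (pure V V (xs ! (i - 1)) (xs ! i)) (\<lambda>y z. M (xs[i - 1 := y, i := z])))"
  (is "multilinear_form d V ?N")
  unfolding multilinear_form_def
proof (intro allI impI, elim conjE)
  fix xs ys assume xs: "set xs \<subseteq> carrier V" and ys: "set ys \<subseteq> carrier V"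
    and len: "length xs + 1 + length ys = d"
  note fD = lin_mapD[OF f]
  have N: "?N (ls @ [a, b] @ rs) = f (pure V V a b) (\<lambda>y z. M (ls @ [y, z] @ rs))"
    if "length ls + 1 = i" for ls a b rs
    using that by (auto simp: nth_append list_update_append)
  consider "length xs + 1 < i" | "length xs + 1 = i" | "length xs = i" | "i < length xs"
    by linarith
  then show "linear_form V (\<lambda>x. ?N (xs @ x # ys))"
  proof cases
    case 1
    obtain ls a b rs where s: "ys = ls @ [a, b] @ rs" "length ls + 1 = i - length xs - 1"
      by (rule list_split_at[of ys "length ys" "i - length xs - 1"]) (use 1 i len in auto)
    then have *: "?N (xs @ x # ys) = f (pure V V a b) (\<lambda>y z. M ((xs @ x # ls) @ [y, z] @ rs))" for x
      using N[of "xs @ x # ls" a b rs] 1 by simp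
    have l: "length xs + length ls + 3 + length rs = d" using len s by simp
    show ?thesis unfolding *
    proof (rule linear_form_slice[OF _ _ _ V, where F = "\<lambda>u y z. M ((xs @ u # ls) @ [y, z] @ rs)"])
      show "f (pure V V a b) \<in> carrier (tens V V)"
        using s ys by (auto intro: fD pure_closed)
      show "linear_form V (\<lambda>u. M ((xs @ u # ls) @ [x, y] @ rs))"
        if "x \<in> carrier V" "y \<in> carrier V" for x y
        using multilinear_formD[OF M, of xs "ls @ [x, y] @ rs"] that l s xs ys by simp
      show "bilinear_form V V (\<lambda>y z. M ((xs @ u # ls) @ [y, z] @ rs))" if "u \<in> carrier V" for u
        using bilinear_slice[OF M, of "xs @ u # ls" rs] that l s xs ys by simp
    qed
  next
    case 2
    then obtain b rs where s: "ys = b # rs" using i len by (cases ys) auto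
    have *: "?N (xs @ x # ys) = f (pure V V x b) (\<lambda>y z. M (xs @ [y, z] @ rs))" for x
      using N[of xs x b rs] 2 s by simp
    show ?thesis unfolding * linear_form_def
      using ys s fD(4) fD(5) by (auto simp: pure_add pure_smult pure_closed)
  next
    case 3
    then obtain ls a where s: "xs = ls @ [a]" using i by (cases xs rule: rev_cases) auto
    have *: "?N (xs @ x # ys) = f (pure V V a x) (\<lambda>y z. M (ls @ [y, z] @ ys))" for x
      using N[of ls a x ys] 3 s by simp
    show ?thesis unfolding * linear_form_def
      using xs s fD(4) fD(5) by (auto simp: pure_add_right pure_smult_right pure_closed)
  next
    case 4
    obtain ls a b rs where s: "xs = ls @ [a, b] @ rs" "length ls + 1 = i"
      by (rule list_split_at[OF refl i(1) 4])
    then have *: "?N (xs @ x # ys) = f (pure V V a b) (\<lambda>y z. M (ls @ [y, z] @ (rs @ x # ys)))" for x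
      using N[of ls a b "rs @ x # ys"] by simp
    have l: "length ls + 3 + length rs + length ys = d" using len s by simp
    show ?thesis unfolding *
    proof (rule linear_form_slice[OF _ _ _ V, where F = "\<lambda>u y z. M (ls @ [y, z] @ (rs @ u # ys))"])
      show "f (pure V V a b) \<in> carrier (tens V V)"
        using s xs by (auto intro: fD pure_closed)
      show "linear_form V (\<lambda>u. M (ls @ [x, y] @ (rs @ u # ys)))"
        if "x \<in> carrier V" "y \<in> carrier V" for x y
        using multilinear_formD[OF M, of "ls @ [x, y] @ rs" ys] that l s xs ys by simp
      show "bilinear_form V V (\<lambda>y z. M (ls @ [y, z] @ (rs @ u # ys)))" if "u \<in> carrier V" for u
        using bilinear_slice[OF M, of ls "rs @ u # ys"] that l s xs ys by simp
    qed
  qed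
qed

lemma map_at_position_pure_power:
  assumes f: "lin_map (tens V V) (tens V V) f" and V: "vspace V"
    and ls: "length ls + 1 = i" "i + 1 + length rs = d"
  shows "map_at_position d V f i (pure_power d V (ls @ [a, b] @ rs)) =
    pure_insert d V ls (f (pure V V a b)) rs"
proof
  fix M
  have "f (pure V V ((ls @ [a, b] @ rs) ! (i - 1)) ((ls @ [a, b] @ rs) ! i))
      (\<lambda>y z. M ((ls @ [a, b] @ rs)[i - 1 := y, i := z])) = f (pure V V a b) (\<lambda>y z. M (ls @ [y, z] @ rs))"
    using ls by (auto simp: nth_append list_update_append)
  moreover have "1 \<le> i" "i < d" using ls by auto
  ultimately show "map_at_position d V f i (pure_power d V (ls @ [a, b] @ rs)) M =
      pure_insert d V ls (f (pure V V a b)) rs M"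
    using multilinear_form_map_at_position[OF f _ _ _ V, of d M i]
    by (auto simp: map_at_position_def pure_insert_def pure_power_def)
qed

text \<open>By definition, \<^const>\<open>map_at_position\<close> precomposes a tensor with an operation on forms; it is
  therefore linear in the tensor for an arbitrary map \<open>f\<close>.\<close>

lemma map_at_position_linear [simp]:
  "map_at_position d V f i (\<lambda>_. 0) = (\<lambda>_. 0)"
  "map_at_position d V f i (\<lambda>M. s M + t M) =
    (\<lambda>M. map_at_position d V f i s M + map_at_position d V f i t M)"
  "map_at_position d V f i (\<lambda>M. c * t M) = (\<lambda>M. c * map_at_position d V f i t M)"
  by (auto simp: map_at_position_def)

lemma lin_map_map_at_position:
  assumes f: "lin_map (tens V V) (tens V V) f" and V: "vspace V" and i: "1 \<le> i" "i < d"
  shows "lin_map (tens_power d V) (tens_power d V) (map_at_position d V f i)"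
proof (rule lin_mapI[OF vspace_tens_power vspace_tens_power])
  fix t assume "t \<in> carrier (tens_power d V)"
  then show "map_at_position d V f i t \<in> carrier (tens_power d V)"
    using i
  proof (induction rule: tens_power_induct_at)
    case (pure ls a b rs)
    then show ?case
      by (simp only: map_at_position_pure_power[OF f V])
        (intro lin_mapD(3)[OF lin_map_pure_insert] lin_mapD(3)[OF f] pure_closed, auto)
  qed (auto intro: tens_power_closed)
qed auto

lemma map_at_position_pure_insert:
  assumes f: "lin_map (tens V V) (tens V V) f" and V: "vspace V"
    and ls: "set ls \<subseteq> carrier V" "set rs \<subseteq> carrier V" "length ls + 1 = i" "i + 1 + length rs = d"
    and w: "w \<in> carrier (tens V V)"
  shows "map_at_position d V f i (pure_insert d V ls w rs) = pure_insert d V ls (f w) rs"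
  using w
proof (induction rule: tens_induct)
  case (pure x y)
  have "length ls + 2 + length rs = d" using ls by simp
  then show ?case
    using ls by (simp only: pure_insert_pure map_at_position_pure_power[OF f V])
next
  have l: "length ls + 2 + length rs = d" using ls by simp
  note I = lin_mapD[OF lin_map_pure_insert[OF ls(1,2) l], simplified]
  note fD = lin_mapD[OF f, simplified]
  {
    case zero
    then show ?case by (simp add: I fD)
  next
    case (add s t)
    then show ?case by (simp add: I fD)
  next
    case (smult c t)
    then show ?case by (simp add: I fD)
  }
qed

lemma map_at_position_compose:
  assumes f: "lin_map (tens V V) (tens V V) f" and g: "lin_map (tens V V) (tens V V) g"
    and V: "vspace V" and i: "1 \<le> i" "i < d" and t: "t \<in> carrier (tens_power d V)"
  shows "map_at_position d V f i (map_at_position d V g i t) = map_at_position d V (\<lambda>x. f (g x)) i t"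
  using t i
proof (induction rule: tens_power_induct_at)
  case (pure ls a b rs)
  have "lin_map (tens V V) (tens V V) (\<lambda>x. f (g x))"
    by (rule lin_mapI[OF vspace_tens vspace_tens]) (use lin_mapD[OF f] lin_mapD[OF g] in auto)
  moreover have "g (pure V V a b) \<in> carrier (tens V V)"
    using pure by (intro lin_mapD[OF g] pure_closed)
  ultimately show ?case
    using pure by (simp only: map_at_position_pure_power[OF _ V] map_at_position_pure_insert[OF f V] g)
qed auto

lemma at_position_generators_closed:
  assumes "L \<subseteq> carrier (tens V V)"
  shows "{pure_insert d V xs w ys | xs w ys. set xs \<subseteq> carrier V \<and> set ys \<subseteq> carrier V \<and>
       length xs + 1 = i \<and> i + 1 + length ys = d \<and> w \<in> L} \<subseteq> carrier (tens_power d V)"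
  using assms by (auto intro!: lin_mapD(3)[OF lin_map_pure_insert])

text \<open>It suffices to look at pure tensors, where \<open>1 \<otimes> f \<otimes> 1\<close> replaces two factors by a value
  of \<open>f\<close>.\<close>

lemma map_at_position_in_at_position:
  assumes V: "vspace V" and f: "lin_map (tens V V) (tens V V) f"
    and L: "\<And>w. w \<in> carrier (tens V V) \<Longrightarrow> f w \<in> L" "L \<subseteq> carrier (tens V V)"
    and i: "1 \<le> i" "i < d" and t: "t \<in> carrier (tens_power d V)"
  shows "map_at_position d V f i t \<in> at_position d V i L"
proof -
  let ?S = "{pure_insert d V xs w ys | xs w ys. set xs \<subseteq> carrier V \<and> set ys \<subseteq> carrier V \<and>
       length xs + 1 = i \<and> i + 1 + length ys = d \<and> w \<in> L}"
  have S: "?S \<subseteq> carrier (tens_power d V)"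
    by (rule at_position_generators_closed[OF L(2)])
  note sD = vsubspaceD[OF vsubspace_span[OF vspace_tens_power S]]
  show ?thesis
    unfolding at_position_def using t i
  proof (induction rule: tens_power_induct_at)
    case (pure ls a b rs)
    then have "pure_insert d V ls (f (pure V V a b)) rs \<in> ?S"
      using L(1)[OF pure_closed] by blast
    then have "pure_insert d V ls (f (pure V V a b)) rs \<in> vspan (tens_power d V) ?S"
      by (rule subsetD[OF subset_span[OF vspace_tens_power S]])
    then show ?case
      by (simp only: map_at_position_pure_power[OF f V pure(5,6)])
  qed (use sD(3-5) in auto)
qed

section \<open>Generalized inverses\<close>

text \<open>Choose a basis of the image of \<open>g\<close>, let \<open>s\<close> send each basis vector to one of its preimages,
  and extend linearly. The bases are taken in the vector space of all functions on \<open>'i\<close>; this is a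
  type, so linear maps prescribed on a basis are available there. For this, \<open>g\<close> is first
  replaced by a linear map on all functions that agrees with it on \<open>U\<close>.\<close>

lemma generalized_inverse:
  fixes U :: "('k::field, 'i \<Rightarrow> 'k) module"
  assumes U: "fun_vspace U" and g: "lin_map U U g"
  obtains s where "lin_map U U s" "\<And>u. u \<in> carrier U \<Longrightarrow> g (s (g u)) = g u"
proof -
  define sc where "sc = (\<lambda>(c::'k) (f::'i \<Rightarrow> 'k) i. c * f i)"
  interpret F: vector_space sc
    by unfold_locales (auto simp: sc_def fun_eq_iff algebra_simps)
  interpret P: vector_space_pair sc sc ..
  note UD = fun_vspaceD(2-4)[OF U] and US = vsubspaceD[OF fun_vspaceD(5)[OF U], simplified]
    and gD = lin_mapD[OF g, unfolded fun_vspaceD(2-4)[OF U]]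
  have plus: "f + h = (\<lambda>i. f i + h i)" for f h :: "'i \<Rightarrow> 'k" by (simp add: fun_eq_iff)
  have zero: "0 = (\<lambda>i::'i. 0::'k)" by (simp add: fun_eq_iff)
  have subU: "F.subspace (carrier U)"
    unfolding F.subspace_def using US(3-5) by (simp add: sc_def plus zero)
  have g_add: "g (x + y) = g x + g y" if "x \<in> carrier U" "y \<in> carrier U" for x y
    unfolding plus using gD(4)[OF that] .
  have g_scale: "g (sc c x) = sc c (g x)" if "x \<in> carrier U" for c x
    unfolding sc_def using gD(5)[OF that] .
  have g_zero: "g 0 = 0" unfolding zero using gD(6) .
  obtain B where B: "B \<subseteq> carrier U" "F.independent B" "carrier U \<subseteq> F.span B"
    by (rule F.maximal_independent_subset)
  \<comment> \<open>\<open>g1\<close> extends \<open>g\<close> from \<open>U\<close> to all functions\<close>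
  define g1 where "g1 = P.construct B g"
  have lin1: "Vector_Spaces.linear sc sc g1" unfolding g1_def by (rule P.linear_construct[OF B(2)])
  note add1 = P.linear_add[OF lin1] and scale1 = P.linear_scale[OF lin1] and zero1 = P.linear_0[OF lin1]
  have g1: "g1 u = g u" if "u \<in> carrier U" for u
  proof -
    have "u \<in> F.span B" using that B by blast
    then have "u \<in> carrier U \<and> g1 u = g u"
    proof (rule F.span_induct)
      show "F.subspace {u. u \<in> carrier U \<and> g1 u = g u}"
        using subU by (auto simp: F.subspace_def add1 scale1 zero1 g_add g_scale g_zero)
    qed (use B P.construct_basis[OF B(2)] in \<open>auto simp: g1_def\<close>)
    then show ?thesis ..
  qed
  \<comment> \<open>a basis of the image, and preimages of its elements in \<open>U\<close>\<close>
  obtain C where C: "C \<subseteq> g1 ` carrier U" "F.independent C" "g1 ` carrier U \<subseteq> F.span C"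
    by (rule F.maximal_independent_subset)
  define p where "p = inv_into (carrier U) g1"
  define s where "s = P.construct C p"
  have lins: "Vector_Spaces.linear sc sc s" unfolding s_def by (rule P.linear_construct[OF C(2)])
  have "p ` C \<subseteq> carrier U" using C(1) by (auto simp: p_def inv_into_into)
  then have "F.span (p ` C) \<subseteq> carrier U" using subU by (rule F.span_minimal)
  then have sU: "s x \<in> carrier U" for x
    using P.construct_in_span[OF C(2)] unfolding s_def by blast
  have "Vector_Spaces.linear sc sc (g1 \<circ> s)" using lins lin1 by (rule Vector_Spaces.linear_compose)
  then have gs: "g1 (s x) = x" if "x \<in> F.span C" for x
    using P.linear_eq_on[of "g1 \<circ> s" id x C] F.linear_id that C(1) P.construct_basis[OF C(2)]
    by (auto simp: s_def p_def f_inv_into_f subset_iff)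
  show ?thesis
  proof (rule that)
    show "lin_map U U s"
      by (rule lin_mapI[OF lin_mapD(1)[OF g] lin_mapD(1)[OF g]])
        (use sU P.linear_add[OF lins] P.linear_scale[OF lins] in \<open>simp_all add: UD plus sc_def\<close>)
    show "g (s (g u)) = g u" if "u \<in> carrier U" for u
      using gs[of "g u"] g1[OF that] g1[OF sU] C(3) that by auto
  qed
qed

section \<open>Generalized eigenspaces at a position\<close>

lemma lin_map_scale:
  assumes "fun_vspace U"
  shows "lin_map U U (\<lambda>x i. c * x i)"
  by (rule lin_mapI) (use fun_vspaceD[OF assms] vsubspaceD(5)[OF fun_vspaceD(5)[OF assms]]
      in \<open>auto simp: algebra_simps\<close>)

lemma lin_map_diff:
  assumes U: "fun_vspace U" and W: "fun_vspace W" and f: "lin_map U W f" and g: "lin_map U W g"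
  shows "lin_map U W (\<lambda>x i. f x i - g x i)"
proof (rule lin_mapI[OF lin_mapD(1)[OF f] lin_mapD(2)[OF f]])
  note WD = fun_vspaceD(2-4)[OF W]
  interpret W: vectorspace class_ring W by (rule fun_vspaceD[OF W])
  show "(\<lambda>i. f x i - g x i) \<in> carrier W" if "x \<in> carrier U" for x
    using fun_vspace_minus[OF W lin_mapD(3)[OF f that] lin_mapD(3)[OF g that]]
      lin_mapD(3)[OF f that] lin_mapD(3)[OF g that] W.M.minus_closed by metis
qed (use lin_mapD[OF f] lin_mapD[OF g] fun_vspaceD(2-4)[OF W] in \<open>auto simp: algebra_simps\<close>)

lemma lin_map_cong:
  assumes "lin_map U W f" and "\<And>x. x \<in> carrier U \<Longrightarrow> f x = g x"
  shows "lin_map U W g"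
proof (rule lin_mapI[OF lin_mapD(1)[OF assms(1)] lin_mapD(2)[OF assms(1)]])
  interpret U: vectorspace class_ring U by (rule lin_mapD[OF assms(1)])
  note fD = lin_mapD[OF assms(1)]
  show "g x \<in> carrier W" if "x \<in> carrier U" for x using fD(3) assms(2) that by metis
  show "g (x \<oplus>\<^bsub>U\<^esub> y) = g x \<oplus>\<^bsub>W\<^esub> g y" if "x \<in> carrier U" "y \<in> carrier U" for x y
    using fD(4)[OF that] assms(2) that U.a_closed by metis
  show "g (c \<odot>\<^bsub>U\<^esub> x) = c \<odot>\<^bsub>W\<^esub> g x" if "x \<in> carrier U" for c x
    using fD(5)[OF that, of c] assms(2)[OF that] assms(2)[of "c \<odot>\<^bsub>U\<^esub> x"] that U.smult_closed[of c x]
    by simp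
qed

lemma lin_map_compose:
  assumes f: "lin_map U V f" and g: "lin_map V W g"
  shows "lin_map U W (\<lambda>x. g (f x))"
  by (rule lin_mapI[OF lin_mapD(1)[OF f] lin_mapD(2)[OF g]]) (simp_all add: lin_mapD[OF f] lin_mapD[OF g])

lemma lin_map_id: "vspace U \<Longrightarrow> lin_map U U (\<lambda>x. x)"
  by (rule lin_mapI) auto

lemma lin_map_funpow:
  assumes "lin_map U U f"
  shows "lin_map U U (f ^^ N)"
proof (induction N)
  case 0
  then show ?case using lin_map_id[OF lin_mapD(1)[OF assms]] by (simp add: id_def)
next
  case (Suc N)
  then show ?case using lin_map_compose[OF Suc assms] by (simp add: o_def)
qed

lemma lin_map_shift:
  assumes U: "fun_vspace U" and f: "lin_map U U f"
  shows "lin_map U U (\<lambda>x. f x \<ominus>\<^bsub>U\<^esub> c \<odot>\<^bsub>U\<^esub> x)"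
proof (rule lin_map_cong[OF lin_map_diff[OF U U f lin_map_scale[OF U, of c]]])
  fix x assume x: "x \<in> carrier U"
  show "(\<lambda>i. f x i - c * x i) = f x \<ominus>\<^bsub>U\<^esub> c \<odot>\<^bsub>U\<^esub> x"
    using fun_vspace_minus[OF U lin_mapD(3)[OF f x] lin_mapD(3)[OF lin_map_scale[OF U] x]]
    by (simp add: fun_vspaceD(4)[OF U])
qed

text \<open>Once a power of \<open>f - c\<close> kills \<open>w\<close>, all higher powers do.\<close>

lemma gen_eigenspace_iff:
  assumes U: "fun_vspace U" and f: "lin_map U U f"
  shows "w \<in> gen_eigenspace U f c \<longleftrightarrow>
    w \<in> carrier U \<and> (\<exists>N. ((\<lambda>x. f x \<ominus>\<^bsub>U\<^esub> c \<odot>\<^bsub>U\<^esub> x) ^^ N) w = \<zero>\<^bsub>U\<^esub>)"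
proof -
  let ?D = "\<lambda>x. f x \<ominus>\<^bsub>U\<^esub> c \<odot>\<^bsub>U\<^esub> x"
  have "(?D ^^ N) w = \<zero>\<^bsub>U\<^esub>" if "(?D ^^ n) w = \<zero>\<^bsub>U\<^esub>" "n \<le> N" for n N
    using that(2)
    by (induction rule: dec_induct) (simp_all add: that(1) lin_mapD(6)[OF lin_map_shift[OF U f]])
  then show ?thesis unfolding gen_eigenspace_def eventually_sequentially by blast
qed

lemma gen_eigenspace_image:
  assumes U: "fun_vspace U" and W: "fun_vspace W"
    and A: "lin_map U U A" and B: "lin_map W W B" and f: "lin_map U W f"
    and comm: "\<And>x. x \<in> carrier U \<Longrightarrow> f (A x) = B (f x)"
    and x: "x \<in> gen_eigenspace U A c"
  shows "f x \<in> gen_eigenspace W B c"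
proof -
  let ?DU = "\<lambda>x. A x \<ominus>\<^bsub>U\<^esub> c \<odot>\<^bsub>U\<^esub> x" and ?DW = "\<lambda>x. B x \<ominus>\<^bsub>W\<^esub> c \<odot>\<^bsub>W\<^esub> x"
  interpret U: vectorspace class_ring U by (rule fun_vspaceD[OF U])
  have D: "f (?DU y) = ?DW (f y)" if "y \<in> carrier U" for y
  proof -
    have "c \<odot>\<^bsub>U\<^esub> y \<in> carrier U" using that by (intro U.smult_closed) auto
    then show ?thesis
      using that by (simp add: lin_mapD(7)[OF f] lin_mapD(3)[OF A] lin_mapD(5)[OF f] comm)
  qed
  have P: "f ((?DU ^^ N) y) = (?DW ^^ N) (f y)" if "y \<in> carrier U" for y N
  proof (induction N)
    case (Suc N)
    then show ?case
      using D[OF lin_mapD(3)[OF lin_map_funpow[OF lin_map_shift[OF U A]] that]] by simp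
  qed simp
  obtain N where xc: "x \<in> carrier U" and N: "(?DU ^^ N) x = \<zero>\<^bsub>U\<^esub>"
    using x unfolding gen_eigenspace_iff[OF U A] by blast
  have "(?DW ^^ N) (f x) = \<zero>\<^bsub>W\<^esub>"
    using P[OF xc, of N] N lin_mapD(6)[OF f] by simp
  then show ?thesis
    unfolding gen_eigenspace_iff[OF W B] using lin_mapD(3)[OF f xc] by blast
qed

text \<open>The hypothesis only asks for \<open>h = f - g\<close> on \<open>V \<otimes> V\<close>, so that \<open>h\<close> may be written with the
  operations of the module \<open>V \<otimes> V\<close>, whose values outside the carrier are unspecified.\<close>

lemma map_at_position_diff:
  assumes f: "lin_map (tens V V) (tens V V) f" and g: "lin_map (tens V V) (tens V V) g"
    and h: "lin_map (tens V V) (tens V V) h"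
    and eq: "\<And>w. w \<in> carrier (tens V V) \<Longrightarrow> h w = (\<lambda>B. f w B - g w B)"
    and V: "vspace V" and i: "1 \<le> i" "i < d" and t: "t \<in> carrier (tens_power d V)"
  shows "map_at_position d V h i t =
    (\<lambda>M. map_at_position d V f i t M - map_at_position d V g i t M)"
  using t i
proof (induction rule: tens_power_induct_at)
  case (pure ls a b rs)
  show ?case
    unfolding map_at_position_pure_power[OF f V pure(5,6)] map_at_position_pure_power[OF g V pure(5,6)]
      map_at_position_pure_power[OF h V pure(5,6)] eq[OF pure_closed[OF pure(2,3)]]
    by (auto simp: pure_insert_def)
qed (auto simp: algebra_simps)

lemma map_at_position_scale:
  assumes f: "lin_map (tens V V) (tens V V) f"
    and eq: "\<And>w. w \<in> carrier (tens V V) \<Longrightarrow> f w = (\<lambda>B. c * w B)"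
    and V: "vspace V" and i: "1 \<le> i" "i < d" and t: "t \<in> carrier (tens_power d V)"
  shows "map_at_position d V f i t = (\<lambda>M. c * t M)"
  using t i
proof (induction rule: tens_power_induct_at)
  case (pure ls a b rs)
  then have l: "length ls + 2 + length rs = d" by simp
  have "pure_insert d V ls (\<lambda>B. c * pure V V a b B) rs = (\<lambda>M. c * pure_insert d V ls (pure V V a b) rs M)"
    by (auto simp: pure_insert_def)
  then show ?case
    by (simp only: map_at_position_pure_power[OF f V pure(5,6)] eq[OF pure_closed[OF pure(2,3)]]
        pure_insert_pure[OF pure(1,4) l])
qed (auto simp: algebra_simps)

lemma map_at_position_id:
  assumes "lin_map (tens V V) (tens V V) f"
    and "\<And>w. w \<in> carrier (tens V V) \<Longrightarrow> f w = w"
    and "vspace V" "1 \<le> i" "i < d" "t \<in> carrier (tens_power d V)"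
  shows "map_at_position d V f i t = t"
  using map_at_position_scale[OF assms(1) _ assms(3-6), of 1] assms(2) by simp

lemma map_at_position_shift:
  assumes f: "lin_map (tens V V) (tens V V) f"
    and V: "vspace V" and i: "1 \<le> i" "i < d" and t: "t \<in> carrier (tens_power d V)"
  shows "map_at_position d V (\<lambda>x. f x \<ominus>\<^bsub>tens V V\<^esub> c \<odot>\<^bsub>tens V V\<^esub> x) i t =
    map_at_position d V f i t \<ominus>\<^bsub>tens_power d V\<^esub> c \<odot>\<^bsub>tens_power d V\<^esub> t"
proof -
  note U = fun_vspace_tens[of V V] and W = fun_vspace_tens_power[of d V]
  let ?c = "\<lambda>x B. c * x B"
  have s: "lin_map (tens V V) (tens V V) ?c" by (rule lin_map_scale[OF U])
  have "map_at_position d V (\<lambda>x. f x \<ominus>\<^bsub>tens V V\<^esub> c \<odot>\<^bsub>tens V V\<^esub> x) i t =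
      (\<lambda>M. map_at_position d V f i t M - map_at_position d V ?c i t M)"
  proof (rule map_at_position_diff[OF f s lin_map_shift[OF U f] _ V i t])
    fix w assume w: "w \<in> carrier (tens V V)"
    show "f w \<ominus>\<^bsub>tens V V\<^esub> c \<odot>\<^bsub>tens V V\<^esub> w = (\<lambda>B. f w B - c * w B)"
      using fun_vspace_minus[OF U lin_mapD(3)[OF f w] lin_mapD(3)[OF s w]] by simp
  qed
  also have "\<dots> = map_at_position d V f i t \<ominus>\<^bsub>tens_power d V\<^esub> c \<odot>\<^bsub>tens_power d V\<^esub> t"
    using fun_vspace_minus[OF W lin_mapD(3)[OF lin_map_map_at_position[OF f V i] t]
        lin_mapD(3)[OF lin_map_scale[OF W, of c] t]]
    by (simp add: map_at_position_scale[OF s refl V i t])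
  finally show ?thesis .
qed

lemma map_at_position_funpow:
  assumes f: "lin_map (tens V V) (tens V V) f"
    and V: "vspace V" and i: "1 \<le> i" "i < d" and t: "t \<in> carrier (tens_power d V)"
  shows "map_at_position d V (f ^^ N) i t = (map_at_position d V f i ^^ N) t"
proof (induction N)
  case 0
  then show ?case
    using map_at_position_id[OF lin_map_funpow[OF f, of 0] _ V i t] by (simp add: id_def)
next
  case (Suc N)
  then show ?case
    using map_at_position_compose[OF f lin_map_funpow[OF f, of N] V i t] by (simp add: o_def)
qed

text \<open>Tensoring with \<open>V\<close> preserves kernels; a generalized inverse \<open>s\<close> of a power \<open>g\<close> of \<open>f - c\<close>
  exhibits the kernel of \<open>1 \<otimes> g \<otimes> 1\<close> as the image of \<open>1 \<otimes> (1 - s g) \<otimes> 1\<close>.\<close>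

lemma gen_eigenspace_map_at_position:
  assumes f: "lin_map (tens V V) (tens V V) f"
    and V: "vspace V" and i: "1 \<le> i" "i < d"
    and t: "t \<in> gen_eigenspace (tens_power d V) (map_at_position d V f i) c"
  shows "t \<in> at_position d V i (gen_eigenspace (tens V V) f c)"
proof -
  note U = fun_vspace_tens[of V V] and W = fun_vspace_tens_power[of d V]
  let ?D = "\<lambda>x. f x \<ominus>\<^bsub>tens V V\<^esub> c \<odot>\<^bsub>tens V V\<^esub> x"
  let ?T = "map_at_position d V f i"
  let ?DT = "\<lambda>t. ?T t \<ominus>\<^bsub>tens_power d V\<^esub> c \<odot>\<^bsub>tens_power d V\<^esub> t"
  note T = lin_map_map_at_position[OF f V i] and D = lin_map_shift[OF U f, of c]
  obtain N where tc: "t \<in> carrier (tens_power d V)" and N: "(?DT ^^ N) t = (\<lambda>_. 0)"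
    using t gen_eigenspace_iff[OF W T] by auto
  define g where "g = ?D ^^ N"
  have g: "lin_map (tens V V) (tens V V) g" unfolding g_def by (rule lin_map_funpow[OF D])
  have "(?DT ^^ n) t = (map_at_position d V ?D i ^^ n) t" for n
  proof (induction n)
    case (Suc n)
    have "(?DT ^^ n) t \<in> carrier (tens_power d V)"
      by (rule lin_mapD(3)[OF lin_map_funpow[OF lin_map_shift[OF W T]] tc])
    then show ?case using Suc map_at_position_shift[OF f V i] by simp
  qed simp
  then have kill: "map_at_position d V g i t = (\<lambda>_. 0)"
    using N unfolding g_def map_at_position_funpow[OF D V i tc] by simp
  obtain s where s: "lin_map (tens V V) (tens V V) s"
    and gsg: "\<And>u. u \<in> carrier (tens V V) \<Longrightarrow> g (s (g u)) = g u"
    using generalized_inverse[OF U g] by blast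
  note sg = lin_map_compose[OF g s] and id = lin_map_id[OF vspace_tens[of V V]]
  \<comment> \<open>\<open>h\<close> takes values in the kernel of \<open>g\<close>, since \<open>g h = g - g s g = 0\<close>\<close>
  define h where "h = (\<lambda>u B. u B - s (g u) B)"
  have h: "lin_map (tens V V) (tens V V) h"
    unfolding h_def by (rule lin_map_diff[OF U U id sg])
  have "map_at_position d V h i t =
      (\<lambda>M. map_at_position d V (\<lambda>u. u) i t M - map_at_position d V (\<lambda>u. s (g u)) i t M)"
    by (rule map_at_position_diff[OF id sg h _ V i tc]) (simp add: h_def)
  also have "\<dots> = t"
    by (simp add: map_at_position_id[OF id refl V i tc] map_at_position_compose[OF s g V i tc, symmetric] kill)
  finally have t_eq: "map_at_position d V h i t = t" .
  have "h u \<in> gen_eigenspace (tens V V) f c" if u: "u \<in> carrier (tens V V)" for u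
  proof -
    have "g (h u) = \<zero>\<^bsub>tens V V\<^esub>"
      using lin_mapD(7)[OF g u lin_mapD(3)[OF sg u]] fun_vspace_minus[OF U u lin_mapD(3)[OF sg u]]
        fun_vspace_minus[OF U lin_mapD(3)[OF g u] lin_mapD(3)[OF g u]] gsg[OF u]
      by (simp add: h_def)
    then show ?thesis
      using lin_mapD(3)[OF h u] unfolding gen_eigenspace_iff[OF U f] g_def by blast
  qed
  then have "map_at_position d V h i t \<in> at_position d V i (gen_eigenspace (tens V V) f c)"
    by (intro map_at_position_in_at_position[OF V h _ _ i tc]) (auto simp: gen_eigenspace_def)
  then show ?thesis by (simp add: t_eq)
qed

lemma vsubspace_at_position:
  assumes "L \<subseteq> carrier (tens V V)"
  shows "vsubspace (tens_power d V) (at_position d V i L)"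
  unfolding at_position_def
  by (rule vsubspace_span[OF vspace_tens_power at_position_generators_closed[OF assms]])

lemma at_position_mono:
  assumes "K \<subseteq> L"
  shows "at_position d V i K \<subseteq> at_position d V i L"
  unfolding at_position_def
  by (rule module.span_is_monotone) (use assms vspace_tens_power in \<open>auto simp: vectorspace_def\<close>)

text \<open>With \<open>c j = - q\<^sup>j\<close> and \<open>c j = q\<^sup>j\<close> for integers \<open>j\<close>, this covers \<open>\<Lambda>\<^sup>2\<close> and \<open>\<Gamma>\<^sup>2\<close>
  uniformly.\<close>

definition gen_eigensum :: "('k::field, 'v) module \<Rightarrow> ('v \<Rightarrow> 'v) \<Rightarrow> ('i \<Rightarrow> 'k) \<Rightarrow> 'v set"
  where "gen_eigensum U f c = vspan U (\<Union>j. gen_eigenspace U f (c j))"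

lemma gen_eigenspace_carrier: "gen_eigenspace U f c \<subseteq> carrier U"
  by (auto simp: gen_eigenspace_def)

lemma vsubspace_gen_eigensum: "vspace U \<Longrightarrow> vsubspace U (gen_eigensum U f c)"
  unfolding gen_eigensum_def using gen_eigenspace_carrier by (intro vsubspace_span) fast+

text \<open>Inserting a generalized eigenvector of \<open>A\<close> gives one of \<open>1 \<otimes> A \<otimes> 1\<close>, which \<open>f\<close> maps to a
  generalized eigenvector of \<open>1 \<otimes> B \<otimes> 1\<close> for the same eigenvalue; preservation of kernels
  brings it back into the required form.\<close>

lemma image_at_position_gen_eigensum:
  assumes A: "lin_map (tens V V) (tens V V) A" and B: "lin_map (tens W W) (tens W W) B"
    and V: "vspace V" and W: "vspace W" and i: "1 \<le> i" "i < d"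
    and f: "lin_map (tens_power d V) (tens_power d W) f"
    and comm: "\<And>t. t \<in> carrier (tens_power d V) \<Longrightarrow>
      f (map_at_position d V A i t) = map_at_position d W B i (f t)"
  shows "f ` at_position d V i (gen_eigensum (tens V V) A c) \<subseteq>
    at_position d W i (gen_eigensum (tens W W) B c)"
proof -
  let ?EV = "gen_eigensum (tens V V) A c" and ?EW = "gen_eigensum (tens W W) B c"
  have EV: "?EV \<subseteq> carrier (tens V V)" and EW: "?EW \<subseteq> carrier (tens W W)"
    by (rule vsubspaceD(2)[OF vsubspace_gen_eigensum[OF vspace_tens]])+
  note target = vsubspace_at_position[OF EW, of d i]
  have gens: "f (pure_insert d V xs w ys) \<in> at_position d W i ?EW"
    if xy: "set xs \<subseteq> carrier V" "set ys \<subseteq> carrier V" "length xs + 1 = i" "i + 1 + length ys = d"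
      and w: "w \<in> ?EV" for xs w ys
  proof -
    have l: "length xs + 2 + length ys = d" using xy by simp
    note I = lin_map_pure_insert[OF xy(1,2) l]
    have eig: "f (pure_insert d V xs w ys) \<in> at_position d W i ?EW"
      if w: "w \<in> gen_eigenspace (tens V V) A (c j)" for w j
    proof -
      have "pure_insert d V xs w ys \<in> gen_eigenspace (tens_power d V) (map_at_position d V A i) (c j)"
        by (rule gen_eigenspace_image[OF fun_vspace_tens fun_vspace_tens_power A
              lin_map_map_at_position[OF A V i] I _ w])
          (rule map_at_position_pure_insert[OF A V xy, symmetric])
      note eigV = this
      have "f (pure_insert d V xs w ys) \<in>
          gen_eigenspace (tens_power d W) (map_at_position d W B i) (c j)"
        by (rule gen_eigenspace_image[OF fun_vspace_tens_power fun_vspace_tens_power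
              lin_map_map_at_position[OF A V i] lin_map_map_at_position[OF B W i] f _ eigV])
          (rule comm)
      then have "f (pure_insert d V xs w ys) \<in> at_position d W i (gen_eigenspace (tens W W) B (c j))"
        by (rule gen_eigenspace_map_at_position[OF B W i])
      moreover have "(\<Union>j. gen_eigenspace (tens W W) B (c j)) \<subseteq> ?EW"
        unfolding gen_eigensum_def by (rule subset_span[OF vspace_tens]) (auto simp: gen_eigenspace_def)
      then have "gen_eigenspace (tens W W) B (c j) \<subseteq> ?EW" by blast
      ultimately show ?thesis by (rule subsetD[OF at_position_mono, rotated])
    qed
    have "(\<lambda>w. f (pure_insert d V xs w ys)) ` ?EV \<subseteq> at_position d W i ?EW"
      unfolding gen_eigensum_def[of "tens V V"]
      by (rule lin_map_span[OF lin_map_compose[OF I f] _ target]) (use eig in \<open>auto simp: gen_eigenspace_def\<close>)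
    then show ?thesis using w unfolding image_subset_iff by (rule bspec)
  qed
  show ?thesis
    unfolding at_position_def[of d V i]
    by (rule lin_map_span[OF f at_position_generators_closed[OF EV] target]) (use gens in blast)
qed

section \<open>Spaces of linear maps and quotient spaces\<close>

lemma hom_space_simps:
  "carrier (hom_space V W P) = {f \<in> extensional (carrier V). lin_map V W f \<and> P f}"
  "\<zero>\<^bsub>hom_space V W P\<^esub> = (\<lambda>x\<in>carrier V. \<zero>\<^bsub>W\<^esub>)"
  "f \<oplus>\<^bsub>hom_space V W P\<^esub> g = (\<lambda>x\<in>carrier V. f x \<oplus>\<^bsub>W\<^esub> g x)"
  "c \<odot>\<^bsub>hom_space V W P\<^esub> f = (\<lambda>x\<in>carrier V. c \<odot>\<^bsub>W\<^esub> f x)"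
  by (simp_all add: hom_space_def)

lemma lin_map_zero:
  assumes "vspace V" "vspace W"
  shows "lin_map V W (\<lambda>x. \<zero>\<^bsub>W\<^esub>)"
proof -
  interpret W: vectorspace class_ring W by fact
  show ?thesis by (rule lin_mapI[OF assms]) simp_all
qed

lemma lin_map_add:
  assumes f: "lin_map V W f" and g: "lin_map V W g"
  shows "lin_map V W (\<lambda>x. f x \<oplus>\<^bsub>W\<^esub> g x)"
proof -
  interpret W: vectorspace class_ring W by (rule lin_mapD(2)[OF f])
  note fD = lin_mapD(3-5)[OF f] and gD = lin_mapD(3-5)[OF g]
  show ?thesis
  proof (rule lin_mapI[OF lin_mapD(1)[OF f] lin_mapD(2)[OF f]])
    show "f (x \<oplus>\<^bsub>V\<^esub> y) \<oplus>\<^bsub>W\<^esub> g (x \<oplus>\<^bsub>V\<^esub> y) = (f x \<oplus>\<^bsub>W\<^esub> g x) \<oplus>\<^bsub>W\<^esub> (f y \<oplus>\<^bsub>W\<^esub> g y)"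
      if "x \<in> carrier V" "y \<in> carrier V" for x y
      using fD(1)[OF that(1)] fD(1)[OF that(2)] gD(1)[OF that(1)] gD(1)[OF that(2)]
      unfolding fD(2)[OF that] gD(2)[OF that] by (simp add: W.a_ac)
    show "f (c \<odot>\<^bsub>V\<^esub> x) \<oplus>\<^bsub>W\<^esub> g (c \<odot>\<^bsub>V\<^esub> x) = c \<odot>\<^bsub>W\<^esub> (f x \<oplus>\<^bsub>W\<^esub> g x)" if "x \<in> carrier V" for c x
      using fD(1)[OF that] gD(1)[OF that] unfolding fD(3)[OF that] gD(3)[OF that]
      by (simp add: W.smult_r_distr)
  qed (simp add: fD gD)
qed

lemma lin_map_smult:
  assumes f: "lin_map V W f"
  shows "lin_map V W (\<lambda>x. c \<odot>\<^bsub>W\<^esub> f x)"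
proof -
  interpret W: vectorspace class_ring W by (rule lin_mapD(2)[OF f])
  note fD = lin_mapD(3-5)[OF f]
  show ?thesis
  proof (rule lin_mapI[OF lin_mapD(1)[OF f] lin_mapD(2)[OF f]])
    show "c \<odot>\<^bsub>W\<^esub> f (b \<odot>\<^bsub>V\<^esub> x) = b \<odot>\<^bsub>W\<^esub> (c \<odot>\<^bsub>W\<^esub> f x)" if "x \<in> carrier V" for b x
      using fD(1)[OF that] W.smult_assoc1[of b c "f x"] W.smult_assoc1[of c b "f x"]
      unfolding fD(3)[OF that] by (simp add: mult.commute)
  qed (use W.smult_closed in \<open>simp_all add: fD W.smult_r_distr\<close>)
qed

lemma vspace_hom_space:
  assumes V: "vspace V" and W: "vspace W"
    and P: "P (\<lambda>x\<in>carrier V. \<zero>\<^bsub>W\<^esub>)"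
      "\<And>f g. lin_map V W f \<Longrightarrow> lin_map V W g \<Longrightarrow> P f \<Longrightarrow> P g \<Longrightarrow> P (\<lambda>x\<in>carrier V. f x \<oplus>\<^bsub>W\<^esub> g x)"
      "\<And>c f. lin_map V W f \<Longrightarrow> P f \<Longrightarrow> P (\<lambda>x\<in>carrier V. c \<odot>\<^bsub>W\<^esub> f x)"
  shows "vspace (hom_space V W P)"
proof -
  interpret W: vectorspace class_ring W by fact
  have smult: "c \<odot>\<^bsub>W\<^esub> x \<in> carrier W" if "x \<in> carrier W" for c x
    using that by (intro W.smult_closed) auto
  have r: "lin_map V W (\<lambda>x\<in>carrier V. f x)" if "lin_map V W f" for f
    by (rule lin_map_cong[OF that]) simp
  have ext: "f = g" if "f \<in> carrier (hom_space V W P)" "g \<in> extensional (carrier V)"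
    "\<And>x. x \<in> carrier V \<Longrightarrow> f x = g x" for f g
    using that by (auto simp: hom_space_simps intro: extensionalityI)
  have val: "f x \<in> carrier W" if "f \<in> carrier (hom_space V W P)" "x \<in> carrier V" for f x
    using that lin_mapD(3) by (auto simp: hom_space_simps)
  show ?thesis
  proof (rule vspaceI)
    show "\<zero>\<^bsub>hom_space V W P\<^esub> \<in> carrier (hom_space V W P)"
      using P(1) r[OF lin_map_zero[OF V W]] by (simp add: hom_space_simps)
    show "f \<oplus>\<^bsub>hom_space V W P\<^esub> g \<in> carrier (hom_space V W P)"
      if "f \<in> carrier (hom_space V W P)" "g \<in> carrier (hom_space V W P)" for f g
      using that P(2) r[OF lin_map_add] by (simp add: hom_space_simps)
    show smultc: "c \<odot>\<^bsub>hom_space V W P\<^esub> f \<in> carrier (hom_space V W P)"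
      if "f \<in> carrier (hom_space V W P)" for c f
      using that P(3) r[OF lin_map_smult] by (simp add: hom_space_simps)
    show "\<exists>g\<in>carrier (hom_space V W P). f \<oplus>\<^bsub>hom_space V W P\<^esub> g = \<zero>\<^bsub>hom_space V W P\<^esub>"
      if f: "f \<in> carrier (hom_space V W P)" for f
    proof (rule bexI)
      show "(-1) \<odot>\<^bsub>hom_space V W P\<^esub> f \<in> carrier (hom_space V W P)" by (rule smultc[OF f])
      have "y \<oplus>\<^bsub>W\<^esub> (-1) \<odot>\<^bsub>W\<^esub> y = \<zero>\<^bsub>W\<^esub>" if y: "y \<in> carrier W" for y
        using W.smult_l_distr[of 1 "-1" y] W.smult_one[OF y] W.smult_l_null[OF y] y by simp
      then show "f \<oplus>\<^bsub>hom_space V W P\<^esub> ((-1) \<odot>\<^bsub>hom_space V W P\<^esub> f) = \<zero>\<^bsub>hom_space V W P\<^esub>"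
        using val[OF f] by (simp add: hom_space_simps cong: restrict_cong)
    qed
    show "f \<oplus>\<^bsub>hom_space V W P\<^esub> g = g \<oplus>\<^bsub>hom_space V W P\<^esub> f"
      if "f \<in> carrier (hom_space V W P)" "g \<in> carrier (hom_space V W P)" for f g
      using val[OF that(1)] val[OF that(2)] by (simp add: hom_space_simps W.a_comm cong: restrict_cong)
    show "(f \<oplus>\<^bsub>hom_space V W P\<^esub> g) \<oplus>\<^bsub>hom_space V W P\<^esub> h = f \<oplus>\<^bsub>hom_space V W P\<^esub> (g \<oplus>\<^bsub>hom_space V W P\<^esub> h)"
      if "f \<in> carrier (hom_space V W P)" "g \<in> carrier (hom_space V W P)" "h \<in> carrier (hom_space V W P)"
      for f g h
      using val[OF that(1)] val[OF that(2)] val[OF that(3)]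
      by (simp add: hom_space_simps W.a_assoc cong: restrict_cong)
    show "f \<oplus>\<^bsub>hom_space V W P\<^esub> \<zero>\<^bsub>hom_space V W P\<^esub> = f" if "f \<in> carrier (hom_space V W P)" for f
      by (rule ext[OF that, symmetric]) (use val[OF that] in \<open>simp_all add: hom_space_simps\<close>)
    show "(a * b) \<odot>\<^bsub>hom_space V W P\<^esub> f = a \<odot>\<^bsub>hom_space V W P\<^esub> (b \<odot>\<^bsub>hom_space V W P\<^esub> f)"
      if "f \<in> carrier (hom_space V W P)" for a b f
      using val[OF that] W.smult_assoc1[of a b] by (simp add: hom_space_simps cong: restrict_cong)
    show "1 \<odot>\<^bsub>hom_space V W P\<^esub> f = f" if "f \<in> carrier (hom_space V W P)" for f
      by (rule ext[OF that, symmetric])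
        (use val[OF that] W.smult_one in \<open>simp_all add: hom_space_simps\<close>)
    show "(a + b) \<odot>\<^bsub>hom_space V W P\<^esub> f =
        a \<odot>\<^bsub>hom_space V W P\<^esub> f \<oplus>\<^bsub>hom_space V W P\<^esub> b \<odot>\<^bsub>hom_space V W P\<^esub> f"
      if "f \<in> carrier (hom_space V W P)" for a b f
      using val[OF that] W.smult_l_distr[of a b] by (simp add: hom_space_simps cong: restrict_cong)
    show "a \<odot>\<^bsub>hom_space V W P\<^esub> (f \<oplus>\<^bsub>hom_space V W P\<^esub> g) =
        a \<odot>\<^bsub>hom_space V W P\<^esub> f \<oplus>\<^bsub>hom_space V W P\<^esub> a \<odot>\<^bsub>hom_space V W P\<^esub> g"
      if "f \<in> carrier (hom_space V W P)" "g \<in> carrier (hom_space V W P)" for a f g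
      using val[OF that(1)] val[OF that(2)] W.smult_r_distr[of a]
      by (simp add: hom_space_simps cong: restrict_cong)
  qed
qed

lemma abelian_subgroup_vsubspace:
  assumes "vsubspace V L"
  shows "abelian_subgroup L V"
proof -
  interpret V: vectorspace class_ring V by (rule vsubspaceD[OF assms])
  note L = vsubspaceD(2-5)[OF assms]
  show ?thesis
  proof (rule abelian_subgroupI3)
    show "additive_subgroup L V"
    proof (rule additive_subgroupI, rule V.add.subgroupI)
      show "\<ominus>\<^bsub>V\<^esub> a \<in> L" if "a \<in> L" for a
      proof -
        have a: "a \<in> carrier V" using that L(1) by blast
        have "(-1) \<odot>\<^bsub>V\<^esub> a \<oplus>\<^bsub>V\<^esub> a = \<zero>\<^bsub>V\<^esub>"
          using V.smult_l_distr[of "-1" 1 a] V.smult_one[OF a] V.smult_l_null[OF a] a by simp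
        then have "\<ominus>\<^bsub>V\<^esub> a = (-1) \<odot>\<^bsub>V\<^esub> a"
          using a L that by (intro V.minus_equality) auto
        then show ?thesis using L(4)[OF that] by metis
      qed
    qed (use L in auto)
  qed unfold_locales
qed

text \<open>This single formula serves the scalar multiplication of the quotient, with \<open>f\<close> a scaling,
  as well as the maps that linear maps induce on quotients.\<close>

lemma image_coset:
  assumes f: "lin_map V W f" and L: "vsubspace V L" and K: "vsubspace W K" and im: "f ` L \<subseteq> K"
    and x: "x \<in> carrier V"
  shows "K <+>\<^bsub>W\<^esub> f ` (L +>\<^bsub>V\<^esub> x) = K +>\<^bsub>W\<^esub> f x"
proof -
  interpret W: vectorspace class_ring W by (rule lin_mapD(2)[OF f])
  interpret V: vectorspace class_ring V by (rule lin_mapD(1)[OF f])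
  note LD = vsubspaceD[OF L] and KD = vsubspaceD[OF K] and fD = lin_mapD[OF f]
  have fx: "f x \<in> carrier W" using fD(3) x .
  show ?thesis
  proof (intro equalityI subsetI)
    fix z assume "z \<in> K <+>\<^bsub>W\<^esub> f ` (L +>\<^bsub>V\<^esub> x)"
    then obtain k l where kl: "k \<in> K" "l \<in> L" "z = k \<oplus>\<^bsub>W\<^esub> f (l \<oplus>\<^bsub>V\<^esub> x)"
      by (auto simp: set_add_def' a_r_coset_def')
    have l: "l \<in> carrier V" and k: "k \<in> carrier W" and fl: "f l \<in> K"
      using kl LD(2) KD(2) im by auto
    have "f l \<in> carrier W" using fl KD(2) by blast
    then have "z = (k \<oplus>\<^bsub>W\<^esub> f l) \<oplus>\<^bsub>W\<^esub> f x"
      unfolding kl(3) fD(4)[OF l x] using k fx by (simp add: W.a_assoc)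
    then show "z \<in> K +>\<^bsub>W\<^esub> f x" using KD(4)[OF kl(1) fl] by (auto simp: a_r_coset_def')
  next
    fix z assume "z \<in> K +>\<^bsub>W\<^esub> f x"
    then obtain k where k: "k \<in> K" "z = k \<oplus>\<^bsub>W\<^esub> f x" by (auto simp: a_r_coset_def')
    moreover have "x = \<zero>\<^bsub>V\<^esub> \<oplus>\<^bsub>V\<^esub> x" using x by simp
    then have "x \<in> L +>\<^bsub>V\<^esub> x" unfolding a_r_coset_def' using LD(3) by blast
    ultimately show "z \<in> K <+>\<^bsub>W\<^esub> f ` (L +>\<^bsub>V\<^esub> x)" by (auto simp: set_add_def')
  qed
qed

lemma quot_space_simps:
  "carrier (quot_space V L) = a_rcosets\<^bsub>V\<^esub> L"
  "\<zero>\<^bsub>quot_space V L\<^esub> = L"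
  "C \<oplus>\<^bsub>quot_space V L\<^esub> D = C <+>\<^bsub>V\<^esub> D"
  "c \<odot>\<^bsub>quot_space V L\<^esub> C = quot_smult V L c C"
  by (simp_all add: quot_space_def)

lemma quot_space_coset:
  assumes L: "vsubspace V L"
  shows "x \<in> carrier V \<Longrightarrow> L +>\<^bsub>V\<^esub> x \<in> carrier (quot_space V L)"
    and "\<zero>\<^bsub>quot_space V L\<^esub> = L +>\<^bsub>V\<^esub> \<zero>\<^bsub>V\<^esub>"
    and "x \<in> carrier V \<Longrightarrow> y \<in> carrier V \<Longrightarrow>
      (L +>\<^bsub>V\<^esub> x) \<oplus>\<^bsub>quot_space V L\<^esub> (L +>\<^bsub>V\<^esub> y) = L +>\<^bsub>V\<^esub> (x \<oplus>\<^bsub>V\<^esub> y)"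
    and "x \<in> carrier V \<Longrightarrow> c \<odot>\<^bsub>quot_space V L\<^esub> (L +>\<^bsub>V\<^esub> x) = L +>\<^bsub>V\<^esub> (c \<odot>\<^bsub>V\<^esub> x)"
proof -
  interpret V: vectorspace class_ring V by (rule vsubspaceD[OF L])
  interpret L: abelian_subgroup L V by (rule abelian_subgroup_vsubspace[OF L])
  show "x \<in> carrier V \<Longrightarrow> L +>\<^bsub>V\<^esub> x \<in> carrier (quot_space V L)"
    by (auto simp: quot_space_simps A_RCOSETS_def')
  show "\<zero>\<^bsub>quot_space V L\<^esub> = L +>\<^bsub>V\<^esub> \<zero>\<^bsub>V\<^esub>"
    using V.a_coset_add_zero[OF L.a_subset] by (simp add: quot_space_simps)
  show "x \<in> carrier V \<Longrightarrow> y \<in> carrier V \<Longrightarrow>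
      (L +>\<^bsub>V\<^esub> x) \<oplus>\<^bsub>quot_space V L\<^esub> (L +>\<^bsub>V\<^esub> y) = L +>\<^bsub>V\<^esub> (x \<oplus>\<^bsub>V\<^esub> y)"
    by (simp add: quot_space_simps L.a_rcos_sum)
  show "c \<odot>\<^bsub>quot_space V L\<^esub> (L +>\<^bsub>V\<^esub> x) = L +>\<^bsub>V\<^esub> (c \<odot>\<^bsub>V\<^esub> x)" if x: "x \<in> carrier V"
    unfolding quot_space_simps quot_smult_def
    by (rule image_coset[OF lin_map_smult[OF lin_map_id[OF vsubspaceD(1)[OF L]]] L L _ x])
      (use vsubspaceD(5)[OF L] in auto)
qed

lemma quot_space_cases:
  assumes "C \<in> carrier (quot_space V L)"
  obtains x where "x \<in> carrier V" "C = L +>\<^bsub>V\<^esub> x"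
  using assms by (auto simp: quot_space_simps A_RCOSETS_def')

lemma vspace_quot_space:
  assumes L: "vsubspace V L"
  shows "vspace (quot_space V L)"
proof -
  interpret V: vectorspace class_ring V by (rule vsubspaceD[OF L])
  note Q = quot_space_coset[OF L]
  have smult: "c \<odot>\<^bsub>V\<^esub> x \<in> carrier V" if "x \<in> carrier V" for c x
    using that by (intro V.smult_closed) auto
  let ?Q = "quot_space V L"
  show ?thesis
  proof (rule vspaceI)
    show "\<zero>\<^bsub>?Q\<^esub> \<in> carrier ?Q" unfolding Q(2) by (rule Q(1)) simp
    show "C \<oplus>\<^bsub>?Q\<^esub> D \<in> carrier ?Q" if "C \<in> carrier ?Q" "D \<in> carrier ?Q" for C D
      by (rule quot_space_cases[OF that(1)], rule quot_space_cases[OF that(2)]) (simp add: Q)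
    show "c \<odot>\<^bsub>?Q\<^esub> C \<in> carrier ?Q" if "C \<in> carrier ?Q" for C c
      by (rule quot_space_cases[OF that(1)]) (simp add: Q smult)
    show "\<exists>D\<in>carrier ?Q. C \<oplus>\<^bsub>?Q\<^esub> D = \<zero>\<^bsub>?Q\<^esub>" if C: "C \<in> carrier ?Q" for C
    proof -
      obtain x where x: "x \<in> carrier V" "C = L +>\<^bsub>V\<^esub> x" using quot_space_cases[OF C] .
      then have "C \<oplus>\<^bsub>?Q\<^esub> (L +>\<^bsub>V\<^esub> (\<ominus>\<^bsub>V\<^esub> x)) = \<zero>\<^bsub>?Q\<^esub>" by (simp add: Q V.r_neg)
      moreover have "L +>\<^bsub>V\<^esub> (\<ominus>\<^bsub>V\<^esub> x) \<in> carrier ?Q" using x by (simp add: Q)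
      ultimately show ?thesis by blast
    qed
    show "C \<oplus>\<^bsub>?Q\<^esub> D = D \<oplus>\<^bsub>?Q\<^esub> C" if "C \<in> carrier ?Q" "D \<in> carrier ?Q" for C D
      by (rule quot_space_cases[OF that(1)], rule quot_space_cases[OF that(2)]) (simp add: Q V.a_comm)
    show "(C \<oplus>\<^bsub>?Q\<^esub> D) \<oplus>\<^bsub>?Q\<^esub> E = C \<oplus>\<^bsub>?Q\<^esub> (D \<oplus>\<^bsub>?Q\<^esub> E)"
      if "C \<in> carrier ?Q" "D \<in> carrier ?Q" "E \<in> carrier ?Q" for C D E
      by (rule quot_space_cases[OF that(1)], rule quot_space_cases[OF that(2)],
          rule quot_space_cases[OF that(3)]) (simp add: Q V.a_assoc)
    show "C \<oplus>\<^bsub>?Q\<^esub> \<zero>\<^bsub>?Q\<^esub> = C" if "C \<in> carrier ?Q" for C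
      by (rule quot_space_cases[OF that(1)]) (simp add: Q)
    show "(a * b) \<odot>\<^bsub>?Q\<^esub> C = a \<odot>\<^bsub>?Q\<^esub> (b \<odot>\<^bsub>?Q\<^esub> C)" if "C \<in> carrier ?Q" for a b C
      by (rule quot_space_cases[OF that(1)]) (use V.smult_assoc1[of a b] in \<open>simp add: Q smult\<close>)
    show "1 \<odot>\<^bsub>?Q\<^esub> C = C" if "C \<in> carrier ?Q" for C
      by (rule quot_space_cases[OF that(1)]) (use V.smult_one in \<open>simp add: Q\<close>)
    show "(a + b) \<odot>\<^bsub>?Q\<^esub> C = a \<odot>\<^bsub>?Q\<^esub> C \<oplus>\<^bsub>?Q\<^esub> b \<odot>\<^bsub>?Q\<^esub> C" if "C \<in> carrier ?Q" for a b C
      by (rule quot_space_cases[OF that(1)]) (use V.smult_l_distr[of a b] in \<open>simp add: Q smult\<close>)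
    show "a \<odot>\<^bsub>?Q\<^esub> (C \<oplus>\<^bsub>?Q\<^esub> D) = a \<odot>\<^bsub>?Q\<^esub> C \<oplus>\<^bsub>?Q\<^esub> a \<odot>\<^bsub>?Q\<^esub> D"
      if "C \<in> carrier ?Q" "D \<in> carrier ?Q" for a C D
      by (rule quot_space_cases[OF that(1)], rule quot_space_cases[OF that(2)])
        (use V.smult_r_distr[of a] in \<open>simp add: Q smult\<close>)
  qed
qed

lemma fin_dim_quot_space:
  assumes L: "vsubspace V L" and fd: "vectorspace.fin_dim class_ring V"
  shows "vectorspace.fin_dim class_ring (quot_space V L)"
proof (rule fin_dim_image[OF _ _ fd])
  show "lin_map V (quot_space V L) (\<lambda>x. L +>\<^bsub>V\<^esub> x)"
    by (rule lin_mapI[OF vsubspaceD(1)[OF L] vspace_quot_space[OF L]]) (simp_all add: quot_space_coset[OF L])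
  show "(\<lambda>x. L +>\<^bsub>V\<^esub> x) ` carrier V = carrier (quot_space V L)"
    using quot_space_coset(1)[OF L] quot_space_cases[of _ V L] by blast
qed

section \<open>Finite dimensionality of tensor powers\<close>

text \<open>Expand one factor after another in the generators: \<open>xs\<close> holds the factors that are
  already generators.\<close>

lemma pure_power_in_span_generators:
  assumes V: "vspace V" and A: "A \<subseteq> carrier V" "vspan V A = carrier V"
    and "set xs \<subseteq> A" "set ys \<subseteq> carrier V" "length xs + length ys = d"
  shows "pure_power d V (xs @ ys) \<in>
    vspan (tens_power d V) {pure_power d V zs | zs. set zs \<subseteq> A \<and> length zs = d}"
  using assms(4-6)
proof (induction ys arbitrary: xs)
  let ?S = "{pure_power d V zs | zs. set zs \<subseteq> A \<and> length zs = d}"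
  have S: "?S \<subseteq> carrier (tens_power d V)" using A(1) by (auto intro!: pure_power_closed)
  {
    case Nil
    then have "pure_power d V (xs @ []) \<in> ?S" by auto
    then show ?case by (rule subsetD[OF subset_span[OF vspace_tens_power S]])
  next
    case (Cons y ys)
    interpret V: vectorspace class_ring V by fact
    note sD = vsubspaceD(3-5)[OF vsubspace_span[OF vspace_tens_power S], simplified]
    have xs: "set xs \<subseteq> carrier V" and ys: "set ys \<subseteq> carrier V" and y: "y \<in> vspan V A"
      using Cons.prems A by auto
    have M: "linear_form V (\<lambda>x. M (xs @ x # ys))" if "multilinear_form d V M" for M
      using multilinear_formD[OF that xs ys] Cons.prems(3) by simp
    have car: "x \<in> carrier V" if "x \<in> vspan V A" for x using that A(2) by simp
    show ?case
      using V A(1) y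
    proof (induction rule: span_induct)
      case (base x)
      then show ?case using Cons.IH[of "xs @ [x]"] Cons.prems by simp
    next
      case zero
      have "pure_power d V (xs @ \<zero>\<^bsub>V\<^esub> # ys) = (\<lambda>_. 0)"
      proof
        fix N
        have "N (xs @ (0 \<odot>\<^bsub>V\<^esub> \<zero>\<^bsub>V\<^esub>) # ys) = 0 * N (xs @ \<zero>\<^bsub>V\<^esub> # ys)" if "multilinear_form d V N"
          using M[OF that] V.zero_closed unfolding linear_form_def by blast
        moreover have "0 \<odot>\<^bsub>V\<^esub> \<zero>\<^bsub>V\<^esub> = \<zero>\<^bsub>V\<^esub>" by (rule V.smult_r_null) simp
        ultimately show "pure_power d V (xs @ \<zero>\<^bsub>V\<^esub> # ys) N = 0" by (simp add: pure_power_def)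
      qed
      then show ?case using sD(1) by simp
    next
      case (add x z)
      have "pure_power d V (xs @ (x \<oplus>\<^bsub>V\<^esub> z) # ys) =
          (\<lambda>N. pure_power d V (xs @ x # ys) N + pure_power d V (xs @ z # ys) N)"
        using M car[OF add(1)] car[OF add(2)] by (auto simp: pure_power_def linear_form_def)
      then show ?case using sD(2)[OF add(3,4)] by simp
    next
      case (smult c x)
      have "pure_power d V (xs @ (c \<odot>\<^bsub>V\<^esub> x) # ys) = (\<lambda>N. c * pure_power d V (xs @ x # ys) N)"
        using M car[OF smult(1)] by (auto simp: pure_power_def linear_form_def)
      then show ?case using sD(3)[OF smult(2), of c] by simp
    qed
  }
qed

lemma fin_dim_tens_power:
  assumes V: "vspace V" and fd: "vectorspace.fin_dim class_ring V"
  shows "vectorspace.fin_dim class_ring (tens_power d V)"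
proof -
  obtain A where A: "finite A" "A \<subseteq> carrier V" "vspan V A = carrier V"
    using fd fin_dim_iff[OF V] by blast
  let ?S = "{pure_power d V zs | zs. set zs \<subseteq> A \<and> length zs = d}"
  have S: "?S \<subseteq> carrier (tens_power d V)" using A(2) by (auto intro!: pure_power_closed)
  have "?S = pure_power d V ` {zs. set zs \<subseteq> A \<and> length zs = d}" by auto
  then have fin: "finite ?S" using finite_lists_length_eq[OF A(1), of d] by simp
  note sD = vsubspaceD[OF vsubspace_span[OF vspace_tens_power S]]
  have "t \<in> vspan (tens_power d V) ?S" if "t \<in> carrier (tens_power d V)" for t
    using that
  proof (induction rule: tens_power_induct)
    case (pure xs)
    then show ?case using pure_power_in_span_generators[OF V A(2,3), of "[]" xs d] by simp
  qed (use sD(3-5) in auto)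
  then have "vspan (tens_power d V) ?S = carrier (tens_power d V)" using sD(2) by blast
  then show ?thesis using fin S fin_dim_iff[OF vspace_tens_power[of d V]] by blast
qed

section \<open>The action of the braid group\<close>

lemma lin_map_inv_into:
  assumes f: "lin_map U W f" and bij: "bij_betw f (carrier U) (carrier W)"
  shows "lin_map W U (inv_into (carrier U) f)"
proof -
  interpret U: vectorspace class_ring U by (rule lin_mapD(1)[OF f])
  note fD = lin_mapD[OF f]
  let ?g = "inv_into (carrier U) f"
  have g: "?g y \<in> carrier U" "f (?g y) = y" if "y \<in> carrier W" for y
    using that bij by (auto simp: bij_betw_def inv_into_into f_inv_into_f)
  have eq: "?g y = x" if "x \<in> carrier U" "f x = y" for x y
    using that bij by (auto simp: bij_betw_def)
  show ?thesis
  proof (rule lin_mapI[OF fD(2,1)])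
    show "?g y \<in> carrier U" if "y \<in> carrier W" for y using g(1)[OF that] .
    show "?g (y \<oplus>\<^bsub>W\<^esub> z) = ?g y \<oplus>\<^bsub>U\<^esub> ?g z" if y: "y \<in> carrier W" and z: "z \<in> carrier W" for y z
      by (rule eq) (simp_all add: g[OF y] g[OF z] fD(4))
    show "?g (c \<odot>\<^bsub>W\<^esub> y) = c \<odot>\<^bsub>U\<^esub> ?g y" if y: "y \<in> carrier W" for c y
      by (rule eq) (use U.smult_closed[of c "?g y"] in \<open>simp_all add: g[OF y] fD(5)\<close>)
  qed
qed

text \<open>The inverse is \<open>1 \<otimes> f\<^sup>-\<^sup>1 \<otimes> 1\<close>.\<close>

lemma bij_betw_map_at_position:
  assumes f: "lin_map (tens V V) (tens V V) f"
    and bij: "bij_betw f (carrier (tens V V)) (carrier (tens V V))"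
    and V: "vspace V" and i: "1 \<le> i" "i < d"
  shows "bij_betw (map_at_position d V f i) (carrier (tens_power d V)) (carrier (tens_power d V))"
proof -
  let ?g = "inv_into (carrier (tens V V)) f"
  have g: "lin_map (tens V V) (tens V V) ?g" by (rule lin_map_inv_into[OF f bij])
  note Tf = lin_mapD(3)[OF lin_map_map_at_position[OF f V i]]
    and Tg = lin_mapD(3)[OF lin_map_map_at_position[OF g V i]]
  show ?thesis
  proof (rule bij_betw_byWitness[where f' = "map_at_position d V ?g i"])
    show "\<forall>t\<in>carrier (tens_power d V). map_at_position d V ?g i (map_at_position d V f i t) = t"
    proof
      fix t assume t: "t \<in> carrier (tens_power d V)"
      show "map_at_position d V ?g i (map_at_position d V f i t) = t"
        unfolding map_at_position_compose[OF g f V i t]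
        by (rule map_at_position_id[OF lin_map_compose[OF f g] _ V i t])
          (use bij in \<open>auto simp: bij_betw_def\<close>)
    qed
    show "\<forall>t\<in>carrier (tens_power d V). map_at_position d V f i (map_at_position d V ?g i t) = t"
    proof
      fix t assume t: "t \<in> carrier (tens_power d V)"
      show "map_at_position d V f i (map_at_position d V ?g i t) = t"
        unfolding map_at_position_compose[OF f g V i t]
        by (rule map_at_position_id[OF lin_map_compose[OF g f] _ V i t])
          (use bij in \<open>auto simp: bij_betw_def f_inv_into_f\<close>)
    qed
  qed (use Tf Tg in blast)+
qed

locale braided_powers =
  fixes q :: "'k::field" and d e :: nat and R :: "('k, 'v) braidings"
  assumes braiding: "\<And>n. 1 \<le> n \<Longrightarrow> braiding q n (R n)"
begin

abbreviation TP :: "('k, 'v) hecke \<Rightarrow> ('k, ('k, 'v) tensors) module"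
  where "TP V \<equiv> tens_power d (vs V)"

lemma hecke_pair_space:
  assumes "hecke_pair q e V"
  shows "vspace (vs V)" "vectorspace.fin_dim class_ring (vs V)"
  using assms unfolding hecke_pair_def fd_comodule_def by auto

lemma R_self:
  assumes V: "hecke_pair q e V"
  shows "lin_map (tens (vs V) (vs V)) (tens (vs V) (vs V)) (R_self R V)"
    and "bij_betw (R_self R V) (carrier (tens (vs V) (vs V))) (carrier (tens (vs V) (vs V)))"
proof -
  have V': "1 \<le> fst V" "fd_comodule q (fst V) (snd V)" using V by (auto simp: hecke_pair_def)
  have "comodule_iso q (fst V) (tens_comodule q (fst V) (snd V) (snd V))
      (tens_comodule q (fst V) (snd V) (snd V)) (R_self R V)"
    unfolding R_self_def
    by (rule conjunct1[OF braiding[OF V'(1), unfolded braiding_def], rule_format]) (use V'(2) in blast)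
  then show "lin_map (tens (vs V) (vs V)) (tens (vs V) (vs V)) (R_self R V)"
    and "bij_betw (R_self R V) (carrier (tens (vs V) (vs V))) (carrier (tens (vs V) (vs V)))"
    by (auto simp: comodule_iso_def comodule_hom_def tens_comodule_def)
qed

lemma lin_map_braid_letter:
  assumes V: "hecke_pair q e V" and i: "1 \<le> i" "i < d"
  shows "lin_map (TP V) (TP V) (braid_letter d R V (i, s))"
proof -
  note T = lin_map_map_at_position[OF R_self(1)[OF V] hecke_pair_space(1)[OF V] i]
    and bij = bij_betw_map_at_position[OF R_self[OF V] hecke_pair_space(1)[OF V] i]
  show ?thesis using T lin_map_inv_into[OF T bij] by (cases s) (simp_all add: braid_letter_def)
qed

lemma lin_map_braid_act:
  assumes V: "hecke_pair q e V" and w: "w \<in> braid_words d"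
  shows "lin_map (TP V) (TP V) (braid_act d R V w)"
  using w
proof (induction w)
  case Nil
  show ?case using lin_map_id[OF vspace_tens_power] by (simp add: braid_act_def id_def)
next
  case (Cons a w)
  obtain i s where a: "a = (i, s)" by (cases a)
  have i: "1 \<le> i" "i < d" and "w \<in> braid_words d" using Cons.prems by (auto simp: braid_words_def a)
  then show ?case
    using lin_map_compose[OF Cons.IH lin_map_braid_letter[OF V i, of s]]
    by (simp add: braid_act_def a o_def)
qed

abbreviation HomP :: "('k, 'v) hecke \<Rightarrow> ('k, 'v) hecke \<Rightarrow> ('k, ('k, 'v) tensors \<Rightarrow> ('k, 'v) tensors) module"
  where "HomP V W \<equiv> hom_space (TP V) (TP W) (braid_equivariant d R V W)"

text \<open>Closure of equivariance under addition and scaling uses that every braid acts linearly,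
  including inverses of generators.\<close>

lemma vspace_HomP:
  assumes V: "hecke_pair q e V" and W: "hecke_pair q e W"
  shows "vspace (HomP V W)"
proof (rule vspace_hom_space[OF vspace_tens_power vspace_tens_power])
  note actV = lin_mapD[OF lin_map_braid_act[OF V]] and actW = lin_mapD[OF lin_map_braid_act[OF W]]
  show "braid_equivariant d R V W (\<lambda>x\<in>carrier (TP V). \<zero>\<^bsub>TP W\<^esub>)"
    using actV(3) actW(6) by (simp add: braid_equivariant_def)
  show "braid_equivariant d R V W (\<lambda>x\<in>carrier (TP V). f x \<oplus>\<^bsub>TP W\<^esub> g x)"
    if "lin_map (TP V) (TP W) f" "lin_map (TP V) (TP W) g"
      "braid_equivariant d R V W f" "braid_equivariant d R V W g" for f g
    unfolding braid_equivariant_def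
  proof (intro ballI)
    fix w t assume w: "w \<in> braid_words d" and t: "t \<in> carrier (TP V)"
    have "f (braid_act d R V w t) = braid_act d R W w (f t)"
      "g (braid_act d R V w t) = braid_act d R W w (g t)"
      using that(3,4) w t unfolding braid_equivariant_def by blast+
    then show "(\<lambda>x\<in>carrier (TP V). f x \<oplus>\<^bsub>TP W\<^esub> g x) (braid_act d R V w t) =
        braid_act d R W w ((\<lambda>x\<in>carrier (TP V). f x \<oplus>\<^bsub>TP W\<^esub> g x) t)"
      using actV(3)[OF w t] t actW(4)[OF w lin_mapD(3)[OF that(1) t] lin_mapD(3)[OF that(2) t]]
      by (simp del: tens_simps)
  qed
  show "braid_equivariant d R V W (\<lambda>x\<in>carrier (TP V). c \<odot>\<^bsub>TP W\<^esub> f x)"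
    if "lin_map (TP V) (TP W) f" "braid_equivariant d R V W f" for c f
    unfolding braid_equivariant_def
  proof (intro ballI)
    fix w t assume w: "w \<in> braid_words d" and t: "t \<in> carrier (TP V)"
    have "f (braid_act d R V w t) = braid_act d R W w (f t)"
      using that(2) w t unfolding braid_equivariant_def by blast
    then show "(\<lambda>x\<in>carrier (TP V). c \<odot>\<^bsub>TP W\<^esub> f x) (braid_act d R V w t) =
        braid_act d R W w ((\<lambda>x\<in>carrier (TP V). c \<odot>\<^bsub>TP W\<^esub> f x) t)"
      using actV(3)[OF w t] t actW(5)[OF w lin_mapD(3)[OF that(1) t], of c]
      by (simp del: tens_simps)
  qed
qed

text \<open>For the one-letter word \<open>T\<^sub>i\<close>, equivariance is commutation with \<open>1 \<otimes> R \<otimes> 1\<close>.\<close>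

lemma equivariant_preserves_gen_eigensum:
  assumes V: "hecke_pair q e V" and W: "hecke_pair q e W" and i: "i \<in> {1..<d}"
    and f: "f \<in> carrier (HomP V W)"
  shows "f ` at_position d (vs V) i (gen_eigensum (tens (vs V) (vs V)) (R_self R V) c) \<subseteq>
    at_position d (vs W) i (gen_eigensum (tens (vs W) (vs W)) (R_self R W) c)"
proof (rule image_at_position_gen_eigensum[OF R_self(1)[OF V] R_self(1)[OF W]
      hecke_pair_space(1)[OF V] hecke_pair_space(1)[OF W]])
  show "1 \<le> i" "i < d" using i by auto
  show "lin_map (TP V) (TP W) f" using f by (simp add: hom_space_simps)
  show "f (map_at_position d (vs V) (R_self R V) i t) = map_at_position d (vs W) (R_self R W) i (f t)"
    if t: "t \<in> carrier (TP V)" for t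
  proof -
    have "[(i, True)] \<in> braid_words d" using i by (simp add: braid_words_def)
    moreover have "braid_equivariant d R V W f" using f by (simp add: hom_space_simps)
    ultimately have "f (braid_act d R V [(i, True)] t) = braid_act d R W [(i, True)] (f t)"
      using t unfolding braid_equivariant_def by blast
    then show ?thesis by (simp add: braid_act_def braid_letter_def)
  qed
qed

section \<open>Functors from stable subspaces\<close>

lemma Gamma_category_simps:
  "Ob (Gamma_category q d e R) = {V. hecke_pair q e V}"
  "Hom (Gamma_category q d e R) V W = HomP V W"
  "Comp (Gamma_category q d e R) V W U g f = compose (carrier (TP V)) g f"
  "Ident (Gamma_category q d e R) V = (\<lambda>t\<in>carrier (TP V). t)"
  by (simp_all add: Gamma_category_def)

lemma vect_category_simps:
  "Ob vect_category = {V. vspace V \<and> vectorspace.fin_dim class_ring V}"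
  "Hom vect_category V W = hom_space V W (\<lambda>f. True)"
  "Comp vect_category V W U g f = compose (carrier V) g f"
  "Ident vect_category V = (\<lambda>x\<in>carrier V. x)"
  by (simp_all add: vect_category_def)

lemma HomP_D:
  assumes "f \<in> carrier (HomP V W)"
  shows "lin_map (TP V) (TP W) f"
  using assms by (simp add: hom_space_simps)

lemma restriction_functor:
  assumes L: "\<And>V. hecke_pair q e V \<Longrightarrow> vsubspace (TP V) (L V)"
    and stable: "\<And>V W f. hecke_pair q e V \<Longrightarrow> hecke_pair q e W \<Longrightarrow> f \<in> carrier (HomP V W) \<Longrightarrow>
      f ` L V \<subseteq> L W"
  shows "quantum_polynomial_functor q d e R (\<lambda>V. (TP V)\<lparr>carrier := L V\<rparr>) (\<lambda>V W f. restrict f (L V))"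
  unfolding quantum_polynomial_functor_def linear_functor_def Gamma_category_simps vect_category_simps
proof (intro conjI ballI; (unfold mem_Collect_eq)?)
  fix V :: "('k, 'v) hecke" assume V: "hecke_pair q e V"
  show "vspace ((TP V)\<lparr>carrier := L V\<rparr>) \<and> vectorspace.fin_dim class_ring ((TP V)\<lparr>carrier := L V\<rparr>)"
    using vspace_vsubspace[OF L[OF V]] fin_dim_vsubspace[OF L[OF V] fin_dim_tens_power[OF hecke_pair_space[OF V]]]
    by simp
  show "restrict (\<lambda>t\<in>carrier (TP V). t) (L V) = (\<lambda>x\<in>carrier ((TP V)\<lparr>carrier := L V\<rparr>). x)"
    using vsubspaceD(2)[OF L[OF V]] by (auto simp: restrict_def fun_eq_iff)
next
  fix V W :: "('k, 'v) hecke" assume V: "hecke_pair q e V" and W: "hecke_pair q e W"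
  let ?LV = "(TP V)\<lparr>carrier := L V\<rparr>" and ?LW = "(TP W)\<lparr>carrier := L W\<rparr>"
  note LV = vsubspaceD[OF L[OF V]]
  have car: "t \<in> carrier (TP V)" if "t \<in> L V" for t using LV(2) that by blast
  show "lin_map (HomP V W) (hom_space ?LV ?LW (\<lambda>f. True)) (\<lambda>f. restrict f (L V))"
  proof (rule lin_mapI[OF vspace_HomP[OF V W]])
    show "vspace (hom_space ?LV ?LW (\<lambda>f. True))"
      by (rule vspace_hom_space[OF vspace_vsubspace[OF L[OF V]] vspace_vsubspace[OF L[OF W]]]) simp_all
    show "restrict f (L V) \<in> carrier (hom_space ?LV ?LW (\<lambda>f. True))" if f: "f \<in> carrier (HomP V W)" for f
    proof -
      note fD = lin_mapD[OF HomP_D[OF f]]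
      have "lin_map ?LV ?LW (restrict f (L V))"
      proof (rule lin_mapI[OF vspace_vsubspace[OF L[OF V]] vspace_vsubspace[OF L[OF W]]])
        show "restrict f (L V) x \<in> carrier ?LW" if "x \<in> carrier ?LV" for x
          using stable[OF V W f] that by auto
        show "restrict f (L V) (x \<oplus>\<^bsub>?LV\<^esub> y) = restrict f (L V) x \<oplus>\<^bsub>?LW\<^esub> restrict f (L V) y"
          if "x \<in> carrier ?LV" "y \<in> carrier ?LV" for x y
          using that LV(4) fD(4) car by (simp del: tens_simps)
        show "restrict f (L V) (c \<odot>\<^bsub>?LV\<^esub> x) = c \<odot>\<^bsub>?LW\<^esub> restrict f (L V) x"
          if "x \<in> carrier ?LV" for c x
          using that LV(5) fD(5) car by (simp del: tens_simps)
      qed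
      then show ?thesis by (simp add: hom_space_simps)
    qed
  qed (use car in \<open>auto simp: hom_space_simps restrict_def\<close>)
next
  fix V W U :: "('k, 'v) hecke" and f g
  assume V: "hecke_pair q e V" and W: "hecke_pair q e W" and f: "f \<in> carrier (HomP V W)"
  show "restrict (compose (carrier (TP V)) g f) (L V) =
      compose (carrier ((TP V)\<lparr>carrier := L V\<rparr>)) (restrict g (L W)) (restrict f (L V))"
    using stable[OF V W f] vsubspaceD(2)[OF L[OF V]] by (auto simp: compose_def restrict_def fun_eq_iff)
qed

lemma quotient_functor:
  assumes L: "\<And>V. hecke_pair q e V \<Longrightarrow> vsubspace (TP V) (L V)"
    and stable: "\<And>V W f. hecke_pair q e V \<Longrightarrow> hecke_pair q e W \<Longrightarrow> f \<in> carrier (HomP V W) \<Longrightarrow>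
      f ` L V \<subseteq> L W"
  shows "quantum_polynomial_functor q d e R (\<lambda>V. quot_space (TP V) (L V))
    (\<lambda>V W f. \<lambda>C\<in>carrier (quot_space (TP V) (L V)). L W <+>\<^bsub>TP W\<^esub> f ` C)"
  unfolding quantum_polynomial_functor_def linear_functor_def Gamma_category_simps vect_category_simps
proof (intro conjI ballI; (unfold mem_Collect_eq)?)
  fix V :: "('k, 'v) hecke" assume V: "hecke_pair q e V"
  let ?Q = "quot_space (TP V) (L V)"
  note fd = fin_dim_tens_power[OF hecke_pair_space[OF V], of d]
  show "vspace ?Q \<and> vectorspace.fin_dim class_ring ?Q"
    using vspace_quot_space[OF L[OF V]] fin_dim_quot_space[OF L[OF V] fd] by simp
  show "(\<lambda>C\<in>carrier ?Q. L V <+>\<^bsub>TP V\<^esub> (\<lambda>t\<in>carrier (TP V). t) ` C) = (\<lambda>x\<in>carrier ?Q. x)"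
  proof (rule restrict_ext)
    fix C assume "C \<in> carrier ?Q"
    then obtain x where x: "x \<in> carrier (TP V)" "C = L V +>\<^bsub>TP V\<^esub> x" by (rule quot_space_cases)
    have "lin_map (TP V) (TP V) (\<lambda>t\<in>carrier (TP V). t)"
      by (rule lin_map_cong[OF lin_map_id[OF vspace_tens_power]]) simp
    then have "L V <+>\<^bsub>TP V\<^esub> (\<lambda>t\<in>carrier (TP V). t) ` C = L V +>\<^bsub>TP V\<^esub> (\<lambda>t\<in>carrier (TP V). t) x"
      unfolding x(2) using vsubspaceD(2)[OF L[OF V]] by (intro image_coset L V x) auto
    then show "L V <+>\<^bsub>TP V\<^esub> (\<lambda>t\<in>carrier (TP V). t) ` C = C" using x by simp
  qed
next
  fix V W :: "('k, 'v) hecke" assume V: "hecke_pair q e V" and W: "hecke_pair q e W"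
  let ?QV = "quot_space (TP V) (L V)" and ?QW = "quot_space (TP W) (L W)"
  let ?F = "\<lambda>f. \<lambda>C\<in>carrier ?QV. L W <+>\<^bsub>TP W\<^esub> f ` C"
  note QV = quot_space_coset[OF L[OF V]] and QW = quot_space_coset[OF L[OF W]]
  have F: "?F f (L V +>\<^bsub>TP V\<^esub> x) = L W +>\<^bsub>TP W\<^esub> f x"
    if f: "f \<in> carrier (HomP V W)" and x: "x \<in> carrier (TP V)" for f x
    using image_coset[OF HomP_D[OF f] L[OF V] L[OF W] stable[OF V W f] x] QV(1)[OF x] by simp
  interpret Hom: vectorspace class_ring "HomP V W" by (rule vspace_HomP[OF V W])
  show "lin_map (HomP V W) (hom_space ?QV ?QW (\<lambda>f. True)) ?F"
  proof (rule lin_mapI[OF vspace_HomP[OF V W]])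
    show "vspace (hom_space ?QV ?QW (\<lambda>f. True))"
      by (rule vspace_hom_space[OF vspace_quot_space[OF L[OF V]] vspace_quot_space[OF L[OF W]]]) simp_all
    show "?F f \<in> carrier (hom_space ?QV ?QW (\<lambda>f. True))" if f: "f \<in> carrier (HomP V W)" for f
    proof -
      note fD = lin_mapD[OF HomP_D[OF f]]
      have "lin_map ?QV ?QW (?F f)"
      proof (rule lin_mapI[OF vspace_quot_space[OF L[OF V]] vspace_quot_space[OF L[OF W]]])
        show "?F f C \<in> carrier ?QW" if C: "C \<in> carrier ?QV" for C
          by (rule quot_space_cases[OF C]) (simp only: F[OF f] QW(1) fD(3))
        show "?F f (C \<oplus>\<^bsub>?QV\<^esub> D) = ?F f C \<oplus>\<^bsub>?QW\<^esub> ?F f D"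
          if C: "C \<in> carrier ?QV" and D: "D \<in> carrier ?QV" for C D
        proof -
          obtain x y where x: "x \<in> carrier (TP V)" "C = L V +>\<^bsub>TP V\<^esub> x"
            and y: "y \<in> carrier (TP V)" "D = L V +>\<^bsub>TP V\<^esub> y"
            using quot_space_cases[OF C] quot_space_cases[OF D] by metis
          have xy: "x \<oplus>\<^bsub>TP V\<^esub> y \<in> carrier (TP V)"
            using tens_power_closed(2)[OF x(1) y(1)] by simp
          show ?thesis
            unfolding x(2) y(2) QV(3)[OF x(1) y(1)] F[OF f x(1)] F[OF f y(1)] F[OF f xy]
              fD(4)[OF x(1) y(1)] by (rule QW(3)[symmetric]) (rule fD(3), fact)+
        qed
        show "?F f (c \<odot>\<^bsub>?QV\<^esub> C) = c \<odot>\<^bsub>?QW\<^esub> ?F f C" if C: "C \<in> carrier ?QV" for c C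
        proof -
          obtain x where x: "x \<in> carrier (TP V)" "C = L V +>\<^bsub>TP V\<^esub> x"
            using quot_space_cases[OF C] .
          have cx: "c \<odot>\<^bsub>TP V\<^esub> x \<in> carrier (TP V)"
            using tens_power_closed(3)[OF x(1)] by simp
          show ?thesis
            unfolding x(2) QV(4)[OF x(1)] F[OF f x(1)] F[OF f cx] fD(5)[OF x(1)]
            by (rule QW(4)[symmetric]) (rule fD(3), fact)
        qed
      qed
      then show ?thesis by (simp add: hom_space_simps)
    qed
    show "?F (f \<oplus>\<^bsub>HomP V W\<^esub> g) = ?F f \<oplus>\<^bsub>hom_space ?QV ?QW (\<lambda>f. True)\<^esub> ?F g"
      if f: "f \<in> carrier (HomP V W)" and g: "g \<in> carrier (HomP V W)" for f g
      unfolding hom_space_simps(3)[of ?QV]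
    proof (rule restrict_ext)
      fix C assume C: "C \<in> carrier ?QV"
      then obtain x where x: "x \<in> carrier (TP V)" "C = L V +>\<^bsub>TP V\<^esub> x" by (rule quot_space_cases)
      have "?F (f \<oplus>\<^bsub>HomP V W\<^esub> g) C = L W +>\<^bsub>TP W\<^esub> (f x \<oplus>\<^bsub>TP W\<^esub> g x)"
        unfolding x(2) F[OF Hom.a_closed[OF f g] x(1)] using x(1) by (simp add: hom_space_simps)
      also have "\<dots> = ?F f C \<oplus>\<^bsub>?QW\<^esub> ?F g C"
        unfolding x(2) F[OF f x(1)] F[OF g x(1)]
        by (rule QW(3)[symmetric]) (use lin_mapD(3)[OF HomP_D] f g x in blast)+
      finally show "L W <+>\<^bsub>TP W\<^esub> (f \<oplus>\<^bsub>HomP V W\<^esub> g) ` C = ?F f C \<oplus>\<^bsub>?QW\<^esub> ?F g C"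
        using C by simp
    qed
    show "?F (c \<odot>\<^bsub>HomP V W\<^esub> f) = c \<odot>\<^bsub>hom_space ?QV ?QW (\<lambda>f. True)\<^esub> ?F f"
      if f: "f \<in> carrier (HomP V W)" for c f
      unfolding hom_space_simps(4)[of ?QV]
    proof (rule restrict_ext)
      fix C assume C: "C \<in> carrier ?QV"
      then obtain x where x: "x \<in> carrier (TP V)" "C = L V +>\<^bsub>TP V\<^esub> x" by (rule quot_space_cases)
      have cf: "c \<odot>\<^bsub>HomP V W\<^esub> f \<in> carrier (HomP V W)" using f by (intro Hom.smult_closed) simp
      have "?F (c \<odot>\<^bsub>HomP V W\<^esub> f) C = L W +>\<^bsub>TP W\<^esub> (c \<odot>\<^bsub>TP W\<^esub> f x)"
        unfolding x(2) F[OF cf x(1)] using x(1) by (simp add: hom_space_simps)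
      also have "\<dots> = c \<odot>\<^bsub>?QW\<^esub> ?F f C"
        unfolding x(2) F[OF f x(1)]
        by (rule QW(4)[symmetric]) (use lin_mapD(3)[OF HomP_D] f x in blast)
      finally show "L W <+>\<^bsub>TP W\<^esub> (c \<odot>\<^bsub>HomP V W\<^esub> f) ` C = c \<odot>\<^bsub>?QW\<^esub> ?F f C"
        using C by simp
    qed
  qed
next
  fix V W U :: "('k, 'v) hecke" and f g
  assume V: "hecke_pair q e V" and W: "hecke_pair q e W" and U: "hecke_pair q e U"
    and f: "f \<in> carrier (HomP V W)" and g: "g \<in> carrier (HomP W U)"
  let ?QV = "quot_space (TP V) (L V)" and ?QW = "quot_space (TP W) (L W)"
  let ?gf = "compose (carrier (TP V)) g f"
  have gf: "lin_map (TP V) (TP U) ?gf"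
    by (rule lin_map_cong[OF lin_map_compose[OF HomP_D[OF f] HomP_D[OF g]]]) (simp add: compose_def)
  have gfL: "?gf ` L V \<subseteq> L U"
    using stable[OF V W f] stable[OF W U g] vsubspaceD(2)[OF L[OF V]] by (force simp: compose_def)
  show "(\<lambda>C\<in>carrier ?QV. L U <+>\<^bsub>TP U\<^esub> ?gf ` C) =
      compose (carrier ?QV) (\<lambda>C\<in>carrier ?QW. L U <+>\<^bsub>TP U\<^esub> g ` C) (\<lambda>C\<in>carrier ?QV. L W <+>\<^bsub>TP W\<^esub> f ` C)"
    unfolding compose_def[of "carrier ?QV"]
  proof (rule restrict_ext)
    fix C assume C: "C \<in> carrier ?QV"
    then obtain x where x: "x \<in> carrier (TP V)" "C = L V +>\<^bsub>TP V\<^esub> x" by (rule quot_space_cases)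
    have fx: "f x \<in> carrier (TP W)" using lin_mapD(3)[OF HomP_D[OF f] x(1)] .
    have 1: "L W <+>\<^bsub>TP W\<^esub> f ` C = L W +>\<^bsub>TP W\<^esub> f x"
      unfolding x(2) by (rule image_coset[OF HomP_D[OF f] L[OF V] L[OF W] stable[OF V W f] x(1)])
    have 2: "L U <+>\<^bsub>TP U\<^esub> g ` (L W +>\<^bsub>TP W\<^esub> f x) = L U +>\<^bsub>TP U\<^esub> g (f x)"
      by (rule image_coset[OF HomP_D[OF g] L[OF W] L[OF U] stable[OF W U g] fx])
    have 3: "L U <+>\<^bsub>TP U\<^esub> ?gf ` C = L U +>\<^bsub>TP U\<^esub> g (f x)"
      unfolding x(2) image_coset[OF gf L[OF V] L[OF U] gfL x(1)] using x(1) by (simp add: compose_def)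
    show "L U <+>\<^bsub>TP U\<^esub> ?gf ` C =
        (\<lambda>C\<in>carrier ?QW. L U <+>\<^bsub>TP U\<^esub> g ` C) ((\<lambda>C\<in>carrier ?QV. L W <+>\<^bsub>TP W\<^esub> f ` C) C)"
      using C quot_space_coset(1)[OF L[OF W] fx] by (simp add: 1 2 3)
  qed
qed

section \<open>Quantum symmetric, exterior and divided powers\<close>

lemma Lambda2_eq: "Lambda2 q R V = gen_eigensum (tens (vs V) (vs V)) (R_self R V) (\<lambda>i::int. - (q powi i))"
  by (simp add: Lambda2_def gen_eigensum_def)

lemma Gamma2_eq: "Gamma2 q R V = gen_eigensum (tens (vs V) (vs V)) (R_self R V) (\<lambda>i::int. q powi i)"
  by (simp add: Gamma2_def gen_eigensum_def)

abbreviation eigen_position :: "('i \<Rightarrow> 'k) \<Rightarrow> ('k, 'v) hecke \<Rightarrow> nat \<Rightarrow> ('k, 'v) tensors set"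
  where "eigen_position c V i \<equiv>
    at_position d (vs V) i (gen_eigensum (tens (vs V) (vs V)) (R_self R V) c)"

lemma vsubspace_eigen_position: "vsubspace (TP V) (eigen_position c V i)"
  by (rule vsubspace_at_position[OF vsubspaceD(2)[OF vsubspace_gen_eigensum[OF vspace_tens]]])

text \<open>Covers \<open>\<Lambda>\<^sup>d\<close> and \<open>\<Gamma>\<^sup>d\<close>, which differ only in the eigenvalues. Intersecting with the whole
  tensor power matters for \<open>d \<le> 1\<close>, where there are no positions.\<close>

lemma intersection_functor:
  "quantum_polynomial_functor q d e R
    (\<lambda>V. (TP V)\<lparr>carrier := carrier (TP V) \<inter> (\<Inter>i\<in>{1..<d}. eigen_position c V i)\<rparr>)
    (\<lambda>V W f. restrict f (carrier (TP V) \<inter> (\<Inter>i\<in>{1..<d}. eigen_position c V i)))"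
proof (rule restriction_functor)
  show "vsubspace (TP V) (carrier (TP V) \<inter> (\<Inter>i\<in>{1..<d}. eigen_position c V i))" for V
    by (rule vsubspace_Inter[OF vspace_tens_power vsubspace_eigen_position])
next
  fix V W :: "('k, 'v) hecke" and f assume V: "hecke_pair q e V" and W: "hecke_pair q e W" and f: "f \<in> carrier (HomP V W)"
  show "f ` (carrier (TP V) \<inter> (\<Inter>i\<in>{1..<d}. eigen_position c V i)) \<subseteq>
      carrier (TP W) \<inter> (\<Inter>i\<in>{1..<d}. eigen_position c W i)"
    using lin_mapD(3)[OF HomP_D[OF f]] equivariant_preserves_gen_eigensum[OF V W _ f] by fast
qed

lemma S_power_functor:
  "quantum_polynomial_functor q d e R (S_power q d R) (S_map q d R)"
proof -
  have gens: "(\<Union>i\<in>{1..<d}. at_position d (vs V) i (Lambda2 q R V)) \<subseteq> carrier (TP V)" for V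
    unfolding Lambda2_eq using vsubspaceD(2)[OF vsubspace_eigen_position] by fast
  have "quantum_polynomial_functor q d e R (\<lambda>V. quot_space (TP V) (S_relations q d R V))
    (\<lambda>V W f. \<lambda>C\<in>carrier (quot_space (TP V) (S_relations q d R V)). S_relations q d R W <+>\<^bsub>TP W\<^esub> f ` C)"
  proof (rule quotient_functor)
    show vsubspace: "vsubspace (TP V) (S_relations q d R V)" for V
      unfolding S_relations_def by (rule vsubspace_span[OF vspace_tens_power gens])
    fix V W :: "('k, 'v) hecke" and f assume V: "hecke_pair q e V" and W: "hecke_pair q e W" and f: "f \<in> carrier (HomP V W)"
    have "(\<Union>i\<in>{1..<d}. at_position d (vs W) i (Lambda2 q R W)) \<subseteq> S_relations q d R W"
      unfolding S_relations_def by (rule subset_span[OF vspace_tens_power gens])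
    moreover have "f ` (\<Union>i\<in>{1..<d}. at_position d (vs V) i (Lambda2 q R V)) \<subseteq>
        (\<Union>i\<in>{1..<d}. at_position d (vs W) i (Lambda2 q R W))"
      unfolding Lambda2_eq using equivariant_preserves_gen_eigensum[OF V W _ f] by fast
    ultimately show "f ` S_relations q d R V \<subseteq> S_relations q d R W"
      unfolding S_relations_def[of _ _ _ V]
      by (intro lin_map_span[OF HomP_D[OF f] gens vsubspace]) (rule order_trans)
  qed
  then show ?thesis unfolding S_power_def[abs_def] S_map_def[abs_def] .
qed

lemma Lambda_power_functor:
  "quantum_polynomial_functor q d e R (Lambda_power q d R) (Lambda_map q d R)"
  using intersection_functor[of "\<lambda>i::int. - (q powi i)"]
  unfolding Lambda_power_def[abs_def] Lambda_map_def[abs_def] Lambda2_eq by simp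

lemma Gamma_power_functor:
  "quantum_polynomial_functor q d e R (Gamma_power q d R) (Gamma_map q d R)"
  using intersection_functor[of "\<lambda>i::int. q powi i"]
  unfolding Gamma_power_def[abs_def] Gamma_map_def[abs_def] Gamma2_eq by simp

end

theorem proposition3p10:
  fixes q :: "'k::field_char_0"
    and d e :: nat
    and R :: "('k, 'v) braidings"
  assumes "q \<noteq> 0"
    and "(\<forall>m::nat. 1 \<le> m \<longrightarrow> q ^ m \<noteq> 1) \<or> (\<exists>p::nat. odd p \<and> q ^ p = 1)"
    and "\<And>n. 1 \<le> n \<Longrightarrow> braiding q n (R n)"
  shows "quantum_polynomial_functor q d e R (S_power q d R) (S_map q d R) \<and>
    quantum_polynomial_functor q d e R (Lambda_power q d R) (Lambda_map q d R) \<and>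
    quantum_polynomial_functor q d e R (Gamma_power q d R) (Gamma_map q d R)"
proof -
  interpret braided_powers q d e R by unfold_locales (rule assms(3))
  show ?thesis using S_power_functor Lambda_power_functor Gamma_power_functor by blast
qed

end
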